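(* Algorithm DLE terminates in $O(D_A)$ rounds, i.e., in every fair execution starting from a permitted initial configuration $C_0$, all particles reach a final state within $O(D_A)$ rounds, where $D_A$ is the diameter of $S_P(C_0)$ with respect to distances in the area of $S_P(C_0)$.
   Context: Geometry. The triangular grid $G$ has as vertices ("points") the points of the regular triangular lattice in the plane, adjacent iff at unit distance; each point has six incident edges, cyclically ordered clockwise. A shape is a finite set of points (identified with its induced subgraph). For a connected shape $S$: the unbounded face is the outer face; a bounded face containing a grid point not in $S$ is a hole, whose grid points are hole points; the area of $S$ is $S$ together with its hole points; the outer boundary is the set of points of $S$ on the boundary of the outer face; a boundary point is a point of $S$ adjacent to a point not in $S$. For shapes $S\subseteq S^*$, $dist_{S^*}(u,v)$ is the length of a shortest path between $u,v$ in the subgraph induced by $S^*$, and the diameter of $S$ w.r.t. $S^*$ is $\max_{u,v\in S} dist_{S^*}(u,v)$. For a boundary point $v$, a local boundary $B$ of $v$ w.r.t. $S$ is a maximal clockwise cyclic interval of consecutive edges at $v$ leading to points not in $S$, with boundary count $c(v,B)=|B|-2$. $v$ is redundant if its neighbors in $S$ induce a connected subgraph; erodable if redundant and on the outer boundary (then it has a single local boundary $B$); SCE if erodable and $c(v,B)>0$. Model (amoebot, strong scheduler). Anonymous constant-memory particles each occupy one point (contracted) or two adjacent points (expanded; head and tail); no point is occupied twice. Each particle labels the edges at its point by ports $0,\dots,5$; all share clockwise chirality, and a particle knows the port a neighbor uses for their common edge. Particles read and write neighbors' memories. A contracted particle may expand into an adjacent unoccupied point (its new head); an expanded one may contract into either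 of its points; handovers allowed. An execution is a sequence of atomic activations of single particles; in an activation a particle reads neighbors' memories, computes, writes its own and neighbors' memories, and performs at most one movement. A particle in a final state does nothing when activated. A fair execution activates every particle infinitely often; a round is a minimal execution fragment in which every particle is activated at least once. A permitted initial configuration $C_0$: all particles contracted, at least one particle, set $S_P(C_0)$ of occupied points connected. Input: each particle knows, for each port $i$, whether the point via port $i$ lies in the outer face of $S_P(C_0)$. Algorithm DLE. It maintains a set $S_e$ of eligible points, initially the area of $S_P(C_0)$; points are only removed. Each particle $p$ has $status\in\{undecided,leader,follower\}$ (initially $undecided$) and $eligible[0..5]$ (initially $eligible[i]$ true iff the point via port $i$ is not in the outer face of $S_P(C_0)$), referring to points adjacent to $p$'s head. On activation: (a) if $p$ is expanded, it contracts into its head; (b) else if $p$ and all its neighbors have status $\ne undecided$, $p$ terminates (enters a final state); (c) else if $p.status=undecided$ ($p$ contracted at $v$): if by its $eligible$ array no neighbor of $v$ is in $S_e$, it sets $status:=leader$; else if $v$ is SCE w.r.t. $S_e$, then $v$ is removed from $S_e$ and each neighboring particle whose head is adjacent to $v$ sets its $eligible$ entry for $v$ to false; then, if $v$ has an adjacent point $u\in S_e$ not occupied by any particle, $p$ sets its $eligible$ entries to true except the one for the port from $u$ back to $v$ (set false) and expands into $u$; otherwise $p$ sets $status:=follower$. Otherwise $p$ does nothing. *)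

theory Defs
  imports Main
begin

type_synonym point = "int \<times> int"

text \<open>Axial coordinates; direction i (mod 6) in clockwise cyclic order.\<close>
definition dir :: "nat \<Rightarrow> point" where
  "dir i = [(1,0),(1,-1),(0,-1),(-1,0),(-1,1),(0,1)] ! (i mod 6)"

definition nbr :: "point \<Rightarrow> nat \<Rightarrow> point" where
  "nbr v i = (fst v + fst (dir i), snd v + snd (dir i))"

definition adj :: "point \<Rightarrow> point \<Rightarrow> bool" where
  "adj u v = (\<exists>i<6. v = nbr u i)"

definition connected_shape :: "point set \<Rightarrow> bool" where
  "connected_shape S = (\<forall>u\<in>S. \<forall>v\<in>S. (\<lambda>x y. x \<in> S \<and> y \<in> S \<and> adj x y)\<^sup>*\<^sup>* u v)"

definition outer_face :: "point set \<Rightarrow> point set" where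
  "outer_face S = {q. q \<notin> S \<and> infinite {r. (\<lambda>x y. x \<notin> S \<and> y \<notin> S \<and> adj x y)\<^sup>*\<^sup>* q r}}"

definition hole_points :: "point set \<Rightarrow> point set" where
  "hole_points S = {q. q \<notin> S \<and> q \<notin> outer_face S}"

definition area :: "point set \<Rightarrow> point set" where
  "area S = S \<union> hole_points S"

definition is_path_in :: "point set \<Rightarrow> point list \<Rightarrow> bool" where
  "is_path_in A xs = (xs \<noteq> [] \<and> set xs \<subseteq> A \<and>
     (\<forall>i. Suc i < length xs \<longrightarrow> adj (xs ! i) (xs ! Suc i)))"

definition dist_in :: "point set \<Rightarrow> point \<Rightarrow> point \<Rightarrow> nat" where
  "dist_in A u v = (LEAST n. \<exists>xs. is_path_in A xs \<and> hd xs = u \<and> last xs = v \<and> length xs = Suc n)"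

definition diameter_wrt :: "point set \<Rightarrow> point set \<Rightarrow> nat" where
  "diameter_wrt Sstar S = Max {dist_in Sstar u v | u v. u \<in> S \<and> v \<in> S}"

definition boundary_point :: "point set \<Rightarrow> point \<Rightarrow> bool" where
  "boundary_point S v = (v \<in> S \<and> (\<exists>i<6. nbr v i \<notin> S))"

definition outer_boundary :: "point set \<Rightarrow> point set" where
  "outer_boundary S = {v \<in> S. \<exists>i<6. nbr v i \<in> outer_face S}"

text \<open>Edges at v are identified with direction indices 0..5 (clockwise order).
  B is a local boundary: a maximal cyclic interval of directions leading outside S.\<close>
definition local_boundary :: "point set \<Rightarrow> point \<Rightarrow> nat set \<Rightarrow> bool" where
  "local_boundary S v B = (boundary_point S v \<and>
     (\<exists>i<6. \<exists>l. 1 \<le> l \<and> l \<le> 6 \<and> B = {(i + j) mod 6 | j. j < l} \<and>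
        (\<forall>j<l. nbr v ((i + j) mod 6) \<notin> S) \<and>
        (l < 6 \<longrightarrow> nbr v ((i + 5) mod 6) \<in> S \<and> nbr v ((i + l) mod 6) \<in> S)))"

definition boundary_count :: "nat set \<Rightarrow> int" where
  "boundary_count B = int (card B) - 2"

definition redundant :: "point set \<Rightarrow> point \<Rightarrow> bool" where
  "redundant S v = (v \<in> S \<and> connected_shape {u. u \<in> S \<and> adj v u})"

definition erodable :: "point set \<Rightarrow> point \<Rightarrow> bool" where
  "erodable S v = (redundant S v \<and> v \<in> outer_boundary S)"

definition SCE :: "point set \<Rightarrow> point \<Rightarrow> bool" where
  "SCE S v = (erodable S v \<and> (\<exists>B. local_boundary S v B \<and> boundary_count B > 0))"

datatype status = Undecided | Leader | Follower

text \<open>Particles are identified (for the analysis only) by natural numbers.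
  A particle p is contracted iff head = tail. elig p i refers to port i of p;
  port i of p leads in direction (i + ori p) mod 6 (common chirality).\<close>
record config =
  head :: "nat \<Rightarrow> point"
  tail :: "nat \<Rightarrow> point"
  status :: "nat \<Rightarrow> status"
  elig :: "nat \<Rightarrow> nat \<Rightarrow> bool"
  final :: "nat \<Rightarrow> bool"
  Se :: "point set"

definition port_pt :: "(nat \<Rightarrow> nat) \<Rightarrow> nat \<Rightarrow> point \<Rightarrow> nat \<Rightarrow> point" where
  "port_pt ori p x i = nbr x (i + ori p)"

definition occupied :: "nat set \<Rightarrow> config \<Rightarrow> point \<Rightarrow> bool" where
  "occupied P c x = (\<exists>q\<in>P. head c q = x \<or> tail c q = x)"

definition neighbors :: "nat set \<Rightarrow> config \<Rightarrow> nat \<Rightarrow> nat set" where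
  "neighbors P c p = {q \<in> P. q \<noteq> p \<and>
     (\<exists>x\<in>{head c p, tail c p}. \<exists>y\<in>{head c q, tail c q}. adj x y)}"

definition term_cond :: "nat set \<Rightarrow> config \<Rightarrow> nat \<Rightarrow> bool" where
  "term_cond P c p = (status c p \<noteq> Undecided \<and> (\<forall>q\<in>neighbors P c p. status c q \<noteq> Undecided))"

definition elig_after_removal :: "nat set \<Rightarrow> (nat \<Rightarrow> nat) \<Rightarrow> config \<Rightarrow> nat \<Rightarrow> point \<Rightarrow> nat \<Rightarrow> nat \<Rightarrow> bool" where
  "elig_after_removal P ori c p v = (\<lambda>q j.
     if q \<in> P \<and> q \<noteq> p \<and> adj (head c q) v \<and> port_pt ori q (head c q) j = v then False
     else elig c q j)"

definition dle_step :: "nat set \<Rightarrow> (nat \<Rightarrow> nat) \<Rightarrow> nat \<Rightarrow> config \<Rightarrow> config \<Rightarrow> bool" where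
  "dle_step P ori p c c' = (
     if final c p then c' = c
     else if head c p \<noteq> tail c p then c' = c\<lparr>tail := (tail c)(p := head c p)\<rparr>
     else if term_cond P c p then c' = c\<lparr>final := (final c)(p := True)\<rparr>
     else if status c p = Undecided then
       (let v = head c p in
        if (\<forall>i<6. \<not> elig c p i) then c' = c\<lparr>status := (status c)(p := Leader)\<rparr>
        else if SCE (Se c) v then
          (let Se' = Se c - {v}; el = elig_after_removal P ori c p v in
           if (\<exists>u. adj v u \<and> u \<in> Se' \<and> \<not> occupied P c u) then
             (\<exists>u. adj v u \<and> u \<in> Se' \<and> \<not> occupied P c u \<and>
                c' = c\<lparr>head := (head c)(p := u),
                       elig := el(p := (\<lambda>j. port_pt ori p u j \<noteq> v)),
                       Se := Se'\<rparr>)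
           else c' = c\<lparr>status := (status c)(p := Follower), elig := el, Se := Se'\<rparr>)
        else c' = c)
     else c' = c)"

definition initial_config :: "nat set \<Rightarrow> (nat \<Rightarrow> nat) \<Rightarrow> config \<Rightarrow> bool" where
  "initial_config P ori c = (finite P \<and> P \<noteq> {} \<and> inj_on (head c) P \<and>
     (\<forall>p\<in>P. tail c p = head c p) \<and> connected_shape (head c ` P) \<and>
     (\<forall>p\<in>P. status c p = Undecided \<and> \<not> final c p \<and>
        (\<forall>i<6. elig c p i = (port_pt ori p (head c p) i \<notin> outer_face (head c ` P)))) \<and>
     Se c = area (head c ` P))"

definition dle_execution :: "nat set \<Rightarrow> (nat \<Rightarrow> nat) \<Rightarrow> (nat \<Rightarrow> config) \<Rightarrow> (nat \<Rightarrow> nat) \<Rightarrow> bool" where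
  "dle_execution P ori c a = (\<forall>t. a t \<in> P \<and> dle_step P ori (a t) (c t) (c (Suc t)))"

definition fair :: "nat set \<Rightarrow> (nat \<Rightarrow> nat) \<Rightarrow> bool" where
  "fair P a = (\<forall>p\<in>P. \<forall>t. \<exists>t'\<ge>t. a t' = p)"

text \<open>round_end P a k: index of the first activation after the first k rounds
  (rounds are consecutive minimal fragments activating every particle).\<close>
fun round_end :: "nat set \<Rightarrow> (nat \<Rightarrow> nat) \<Rightarrow> nat \<Rightarrow> nat" where
  "round_end P a 0 = 0"
| "round_end P a (Suc k) =
     (LEAST t. round_end P a k < t \<and> P \<subseteq> a ` {round_end P a k ..< t})"

end

(*
  Let l be a point that is never removed from the set of eligible points. Eligible shapes stay
  connected and free of holes, and removing an SCE point changes no distance d to l among the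
  remaining points. In a hole-free connected shape the lower neighbours of a point are at most two
  and then adjacent, and two adjacent points of equal level have a common lower neighbour. Hence a
  point all of whose upper neighbours are gone is SCE unless it is "flat": two lower neighbours
  between two neighbours of its own level. A flat point becomes SCE when one of these two neighbours
  goes; so it waits for the erosion to travel along its straight row from the nearer end. If
  the nearer end of the row of x is k steps away, then the upper neighbours of x are at most k + 1
  steps away from an end of theirs, and 2 (D - d x) + k is a rank that decreases along all these
  dependencies, D being the eccentricity of l. A point that stays SCE is eroded within two
  rounds, because boundary points of the eligible set are always occupied.

  The structure of levels is proved by induction along erosions, using that a hole-free connected
  shape with at least two points has two SCE points: the extreme points of a shape without cut
  points, or one on either side of a cut point. That a non-redundant point is a cut point is a
  discrete Jordan property, obtained from winding numbers.
*)

theory Submission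
  imports Defs
begin

section \<open>The triangular lattice\<close>

text \<open>Peeling one level after another would charge a whole row for every level, a quadratic
  bound. The rank adds the two delays instead: passing to an upper neighbour gains 2 from the level
  and loses at most 1 in the row, hence the factor 2 on the level. Levels and rows are measured
  once, in the initial area: \<open>d\<close> remains the distance to \<open>l\<close> in every
  later eligible set, and a point that is flat in the current set is flat in the area, so the rank
  is never updated. The centre \<open>l\<close> is chosen in hindsight, as a point that never leaves
  the eligible set. It may be a hole point, so its eccentricity is bounded by three diameters rather
  than one. A row at level \<open>d x\<close> cannot stay flat for \<open>d x\<close> steps on both
  sides, so ranks are at most \<open>2 * D\<close>. Each rank costs two rounds, and three more
  rounds elect the last particle and finish: 12 diameters plus a constant.\<close>

lemma dir_simps [simp]:
  "dir 0 = (1,0)" "dir (Suc 0) = (1,-1)" "dir 1 = (1,-1)" "dir 2 = (0,-1)" "dir 3 = (-1,0)"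
  "dir 4 = (-1,1)" "dir 5 = (0,1)"
  by (simp_all add: dir_def)

lemma dir_mod [simp]: "dir (i mod 6) = dir i"
  by (simp add: dir_def)

lemma less6_iff: "(r::nat) < 6 \<longleftrightarrow> r = 0 \<or> r = 1 \<or> r = 2 \<or> r = 3 \<or> r = 4 \<or> r = 5"
  by auto

text \<open>One step of the direction index is a rotation by 60 degrees, which is linear in axial
  coordinates; so offsets can be computed for a symbolic direction.\<close>

lemma dir_Suc: "dir (Suc i) = (fst (dir i) + snd (dir i), - fst (dir i))"
proof -
  have *: "dir (Suc r) = (fst (dir r) + snd (dir r), - fst (dir r))" if "r < 6" for r
    using that unfolding less6_iff by (elim disjE) (simp_all add: dir_def)
  have "dir (Suc i) = dir (Suc (i mod 6))"
    unfolding dir_def by (simp only: mod_Suc_eq)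
  then show ?thesis using *[of "i mod 6"] by simp
qed

lemma dir_Suc_Suc: "dir (Suc (Suc i)) = (snd (dir i), - fst (dir i) - snd (dir i))"
  by (simp add: dir_Suc)

lemma dir_shift:
  "dir (i + 1) = (fst (dir i) + snd (dir i), - fst (dir i))"
  "dir (i + 2) = (snd (dir i), - fst (dir i) - snd (dir i))"
  "dir (i + 3) = (- fst (dir i), - snd (dir i))"
  "dir (i + 4) = (- fst (dir i) - snd (dir i), fst (dir i))"
  "dir (i + 5) = (- snd (dir i), fst (dir i) + snd (dir i))"
  "dir (i + 6) = dir i"
proof -
  have 3: "dir (i + 3) = (- fst (dir i), - snd (dir i))" for i
    using dir_Suc[of "Suc (Suc i)"] by (simp add: dir_Suc_Suc numeral_3_eq_3)
  show "dir (i + 3) = (- fst (dir i), - snd (dir i))"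
    by (rule 3)
  show "dir (i + 1) = (fst (dir i) + snd (dir i), - fst (dir i))"
    using dir_Suc[of i] by simp
  show "dir (i + 2) = (snd (dir i), - fst (dir i) - snd (dir i))"
    using dir_Suc_Suc[of i] by simp
  show "dir (i + 4) = (- fst (dir i) - snd (dir i), fst (dir i))"
    using dir_Suc[of i] 3[of "Suc i"] by (simp add: numeral_eq_Suc)
  show "dir (i + 5) = (- snd (dir i), fst (dir i) + snd (dir i))"
    using dir_Suc_Suc[of i] 3[of "Suc (Suc i)"] by (simp add: numeral_eq_Suc)
  show "dir (i + 6) = dir i"
    using 3[of i] 3[of "i + 3"] by (simp add: add.assoc)
qed

lemma nbr_mod [simp]: "nbr v (i mod 6) = nbr v i"
  by (simp add: nbr_def)

lemma adj_iff: "adj u v \<longleftrightarrow> (\<exists>i. v = nbr u i)"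
  unfolding adj_def by (metis mod_less_divisor nbr_mod zero_less_numeral)

lemma adj_nbr [simp]: "adj v (nbr v i)"
  by (auto simp: adj_iff)

lemma nbr_add6 [simp]:
  "nbr v (i + 6) = nbr v i" "nbr v (i + 7) = nbr v (i + 1)" "nbr v (i + 8) = nbr v (i + 2)"
  "nbr v (i + 9) = nbr v (i + 3)" "nbr v (i + 10) = nbr v (i + 4)"
proof -
  have *: "nbr v (j + 6) = nbr v j" for j
    using nbr_mod[of v "j + 6"] nbr_mod[of v j] unfolding mod_add_self2 by argo
  have eqs: "i + 7 = i + 1 + 6" "i + 8 = i + 2 + 6" "i + 9 = i + 3 + 6" "i + 10 = i + 4 + 6"
    by linarith+
  show "nbr v (i + 6) = nbr v i"
    by (rule *)
  show "nbr v (i + 7) = nbr v (i + 1)" "nbr v (i + 8) = nbr v (i + 2)"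
    "nbr v (i + 9) = nbr v (i + 3)" "nbr v (i + 10) = nbr v (i + 4)"
    by (subst eqs, rule *)+
qed

lemma adj_coord: "adj u v \<longleftrightarrow> v \<in> {(fst u + 1, snd u), (fst u + 1, snd u - 1), (fst u, snd u - 1),
   (fst u - 1, snd u), (fst u - 1, snd u + 1), (fst u, snd u + 1)}"
proof -
  have "(\<exists>i<6. Q i) \<longleftrightarrow> Q 0 \<or> Q 1 \<or> Q 2 \<or> Q 3 \<or> Q 4 \<or> Q 5" for Q :: "nat \<Rightarrow> bool"
    unfolding less6_iff by blast
  then show ?thesis
    by (simp add: adj_def nbr_def)
qed

lemma adj_sym: "adj u v \<Longrightarrow> adj v u"
  by (cases u; cases v) (auto simp: adj_coord)

lemma adj_commute: "adj u v \<longleftrightarrow> adj v u"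
  using adj_sym by blast

lemma adj_irrefl [simp]: "\<not> adj u u"
  by (cases u) (auto simp: adj_coord)

lemma nbr_ne [simp]: "nbr v i \<noteq> v" "v \<noteq> nbr v i"
  using adj_nbr adj_irrefl by metis+

lemma adj_diff: "adj u v \<longleftrightarrow> (fst v - fst u, snd v - snd u) \<in> {(1,0),(1,-1),(0,-1),(-1,0),(-1,1),(0,1)}"
proof -
  have "(\<exists>i<6. Q i) \<longleftrightarrow> Q 0 \<or> Q 1 \<or> Q 2 \<or> Q 3 \<or> Q 4 \<or> Q 5" for Q :: "nat \<Rightarrow> bool"
    unfolding less6_iff by blast
  moreover have "v = nbr u i \<longleftrightarrow> (fst v - fst u, snd v - snd u) = dir i" for i
    by (cases "dir i") (auto simp: nbr_def prod_eq_iff)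
  ultimately show ?thesis
    unfolding adj_def by (simp only: dir_simps insert_iff empty_iff simp_thms)
qed
text \<open>\<open>around v i r\<close> lists the neighbours of \<open>v\<close> clockwise (\<open>r\<close>) or counterclockwise (\<open>\<not> r\<close>),
  starting in direction \<open>i\<close>; this lets mirror-symmetric arguments be given once.\<close>

definition around :: "point \<Rightarrow> nat \<Rightarrow> bool \<Rightarrow> nat \<Rightarrow> point" where
  "around v i r k = nbr v (i + (if r then k else 5 * k))"

lemma dir_in: "dir i \<in> {(1,0),(1,-1),(0,-1),(-1,0),(-1,1),(0,1)}"
proof -
  have "i mod 6 = 0 \<or> i mod 6 = 1 \<or> i mod 6 = 2 \<or> i mod 6 = 3 \<or> i mod 6 = 4 \<or> i mod 6 = 5"
    using less6_iff[of "i mod 6"] by auto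
  then show ?thesis
    using dir_mod[of i] by (elim disjE) simp_all
qed

text \<open>Rotation by 60 degrees, its sense chosen by \<open>r\<close>. With
  \<open>f = turn r e\<close> the six neighbour offsets are \<open>e\<close>, \<open>f\<close>,
  \<open>f - e\<close> and their negatives.\<close>

definition turn :: "bool \<Rightarrow> point \<Rightarrow> point" where
  "turn r e = (if r then (fst e + snd e, - fst e) else (- snd e, fst e + snd e))"

lemma around_eq:
  assumes "e = dir i" "f = turn r e"
  shows "around v i r 0 = (fst v + fst e, snd v + snd e)"
    "around v i r 1 = (fst v + fst f, snd v + snd f)"
    "around v i r 2 = (fst v + fst f - fst e, snd v + snd f - snd e)"
    "around v i r 3 = (fst v - fst e, snd v - snd e)"
    "around v i r 4 = (fst v - fst f, snd v - snd f)"
    "around v i r 5 = (fst v + fst e - fst f, snd v + snd e - snd f)"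
proof -
  have "dir (i + 10) = dir (i + 4)" "dir (i + 15) = dir (i + 3)" "dir (i + 20) = dir (i + 2)" "dir (i + 25) = dir (i + 1)"
    using dir_shift(6)[of "i + 4"] dir_shift(6)[of "i + 3"] dir_shift(6)[of "i + 9"]
      dir_shift(6)[of "i + 2"] dir_shift(6)[of "i + 8"] dir_shift(6)[of "i + 14"]
      dir_shift(6)[of "i + 1"] dir_shift(6)[of "i + 7"] dir_shift(6)[of "i + 13"] dir_shift(6)[of "i + 19"]
    by (simp_all only: add.assoc, simp_all)
  note d = this[unfolded dir_shift]
  note s = dir_shift[of i]
  have five: "5 * (0::nat) = 0" "5 * (1::nat) = 5" "5 * (2::nat) = 10" "5 * (3::nat) = 15" "5 * (4::nat) = 20" "5 * (5::nat) = 25"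
    by simp_all
  show "around v i r 0 = (fst v + fst e, snd v + snd e)"
    unfolding assms around_def nbr_def five by simp
  show "around v i r 3 = (fst v - fst e, snd v - snd e)"
    unfolding assms around_def nbr_def five using d s(3) by (cases r) (simp_all only: if_True if_False, simp_all)
  show "around v i r 1 = (fst v + fst f, snd v + snd f)"
    "around v i r 2 = (fst v + fst f - fst e, snd v + snd f - snd e)"
    "around v i r 4 = (fst v - fst f, snd v - snd f)"
    "around v i r 5 = (fst v + fst e - fst f, snd v + snd e - snd f)"
    unfolding assms turn_def around_def nbr_def five
    by (cases r; simp only: if_True if_False d s fst_conv snd_conv; simp)+
qed

text \<open>A form made for exhaustive evaluation: six choices of \<open>(x, y)\<close> and two of
  \<open>r\<close> turn all neighbours into concrete offsets from \<open>v\<close>.\<close>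

lemma around_coord:
  obtains x y f g :: int where "(x, y) \<in> {(1,0),(1,-1),(0,-1),(-1,0),(-1,1),(0,1)}"
    "(f, g) = (if r then (x + y, - x) else (- y, x + y))"
    "around v i r 0 = (fst v + x, snd v + y)"
    "around v i r 1 = (fst v + f, snd v + g)"
    "around v i r 2 = (fst v + (f - x), snd v + (g - y))"
    "around v i r 3 = (fst v + - x, snd v + - y)"
    "around v i r 4 = (fst v + - f, snd v + - g)"
    "around v i r 5 = (fst v + (x - f), snd v + (y - g))"
proof -
  obtain x y where e: "dir i = (x, y)" by (cases "dir i")
  obtain f g where f: "turn r (x, y) = (f, g)" by (cases "turn r (x, y)")
  note eqs = around_eq[OF e[symmetric] f[symmetric], of v]
  show thesis
    by (rule that[of x y f g]) (use dir_in[of i] e f eqs in \<open>simp_all add: turn_def split: if_splits\<close>)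
qed

text \<open>The neighbours of a point form an induced hexagon, checked by evaluating every direction
  and orientation. From here on most arguments about neighbourhoods use only indices modulo 6,
  without coordinates.\<close>

lemma
  assumes "k < 6" "l < 6"
  shows adj_around: "adj (around v i r k) (around v i r l) \<longleftrightarrow> l = (k + 1) mod 6 \<or> k = (l + 1) mod 6" (is ?A)
    and around_inj: "around v i r k = around v i r l \<longleftrightarrow> k = l" (is ?B)
proof -
  define D where "D = {(1,0),(1,-1),(0,-1),(-1,0),(-1,1),(0,1::int) :: int \<times> int}"
  have c: "adj (fst v + p, snd v + q) (fst v + p', snd v + q') \<longleftrightarrow> (p' - p, q' - q) \<in> D"
    "(fst v + p, snd v + q) = (fst v + p', snd v + q') \<longleftrightarrow> p = p' \<and> q = q'" for p q p' q'
    unfolding adj_diff D_def by (simp_all only: fst_conv snd_conv add_diff_cancel_left prod.inject add_left_cancel)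
  have "k \<in> {0,1,2,3,4,5}" "l \<in> {0,1,2,3,4,5}"
    using assms unfolding less6_iff by auto
  moreover obtain x y f g :: int where "(x, y) \<in> {(1,0),(1,-1),(0,-1),(-1,0),(-1,1),(0,1)}"
    and fg: "(f, g) = (if r then (x + y, - x) else (- y, x + y))" and eqs:
    "around v i r 0 = (fst v + x, snd v + y)"
    "around v i r 1 = (fst v + f, snd v + g)"
    "around v i r 2 = (fst v + (f - x), snd v + (g - y))"
    "around v i r 3 = (fst v + - x, snd v + - y)"
    "around v i r 4 = (fst v + - f, snd v + - g)"
    "around v i r 5 = (fst v + (x - f), snd v + (y - g))"
    by (rule around_coord)
  ultimately show ?A ?B
    by (atomize (full), cases r)
      (simp_all only: if_True if_False prod.inject,
       (elim insertE emptyE conjE Pair_inject; hypsubst; simp only: eqs c; simp add: D_def)+)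
qed

lemma adj_around_center [simp]: "adj v (around v i r k)" "adj (around v i r k) v"
  using adj_commute by (auto simp: around_def)

lemma around_ne [simp]: "around v i r k \<noteq> v" "v \<noteq> around v i r k"
  by (auto simp: around_def)

text \<open>A count: the six listed points are distinct, and a point has at most six
  neighbours.\<close>

lemma nbrs_eq_around: "{u. adj v u} = around v i r ` {..<6}"
proof -
  have N: "{u. adj v u} = nbr v ` {..<6}"
    by (auto simp: adj_def)
  have "inj_on (around v i r) {..<6}"
    by (auto simp: inj_on_def around_inj)
  then have "card (around v i r ` {..<6}) = 6"
    by (simp add: card_image)
  moreover have "card {u. adj v u} \<le> 6"
    unfolding N by (rule order_trans[OF card_image_le]) auto
  moreover have "around v i r ` {..<6} \<subseteq> {u. adj v u}" "finite {u. adj v u}"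
    by (auto simp: N[symmetric]) (simp add: N)
  ultimately show ?thesis
    by (metis card_seteq)
qed

lemma adj_aroundE:
  assumes "adj v u"
  obtains k where "k < 6" "u = around v i r k"
  using assms nbrs_eq_around[of v i r] by auto

text \<open>Directions keep their meaning at a neighbour, so these are identities between sums of
  lattice vectors. They allow a neighbourhood to be re-read from an adjacent point.\<close>

lemma around_shift:
  "around (around v i r 0) i r 1 = around (around v i r 1) i r 0"
  "around (around v i r 0) i r 2 = around v i r 1"
  "around (around v i r 0) i r 3 = v"
  "around (around v i r 0) i r 4 = around v i r 5"
  "around (around v i r 1) i r 2 = around (around v i r 2) i r 1"
  "around (around v i r 1) i r 3 = around v i r 2"
  "around (around v i r 1) i r 4 = v"
  "around (around v i r 1) i r 5 = around v i r 0"
  "around (around v i r 2) i r 0 = around v i r 1"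
  "around (around v i r 2) i r 3 = around (around v i r 3) i r 2"
  "around (around v i r 2) i r 4 = around v i r 3"
  "around (around v i r 2) i r 5 = v"
  "around (around v i r 3) i r 0 = v"
  "around (around v i r 3) i r 1 = around v i r 2"
  "around (around v i r 4) i r 0 = around v i r 5"
  "around (around v i r 4) i r 1 = v"
  "around (around v i r 5) i r 2 = v"
  by (simp_all only: around_eq[OF refl refl] prod_eq_iff fst_conv snd_conv) simp_all

section \<open>Winding numbers and separation\<close>

text \<open>\<open>cross s t z\<close> is the signed crossing of the edge from \<open>s\<close> to \<open>t\<close> with the ray that leaves \<open>z\<close>
  eastwards, just above the row of \<open>z\<close>; its sum over a closed walk is the winding number around \<open>z\<close>.
  When \<open>z\<close> moves to an adjacent point, the sum over an open walk changes by a quantity \<open>angle\<close> that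
  depends on the two ends of the walk only.\<close>

definition cross :: "point \<Rightarrow> point \<Rightarrow> point \<Rightarrow> int" where
  "cross s t z = (if snd t = snd s + 1 \<and> snd s = snd z \<and> fst s > fst z then 1
     else if snd s = snd t + 1 \<and> snd t = snd z \<and> fst t > fst z then - 1 else 0)"

definition angle :: "point \<Rightarrow> point \<Rightarrow> point \<Rightarrow> int" where
  "angle p z z' = (if snd z' = snd z + 1 then - of_bool (snd p = snd z' \<and> fst p > fst z')
     else if snd z = snd z' + 1 then of_bool (snd p = snd z \<and> fst p > fst z) else 0)"

text \<open>Homotopy invariance edge by edge: summed over a closed walk the \<open>angle\<close>
  terms telescope away, so adjacent points off the walk have the same winding number.\<close>

lemma cross_diff:
  assumes "adj s t" "adj z z'" "z \<noteq> s" "z \<noteq> t" "z' \<noteq> s" "z' \<noteq> t"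
  shows "cross s t z' - cross s t z = angle t z z' - angle s z z'"
proof -
  obtain s1 s2 t1 t2 z1 z2 y1 y2 where e: "s = (s1,s2)" "t = (t1,t2)" "z = (z1,z2)" "z' = (y1,y2)"
    by (cases s; cases t; cases z; cases z') blast
  have "(t1 = s1 + 1 \<and> t2 = s2) \<or> (t1 = s1 + 1 \<and> t2 = s2 - 1) \<or> (t1 = s1 \<and> t2 = s2 - 1) \<or>
    (t1 = s1 - 1 \<and> t2 = s2) \<or> (t1 = s1 - 1 \<and> t2 = s2 + 1) \<or> (t1 = s1 \<and> t2 = s2 + 1)"
    using assms(1) by (simp add: adj_coord e)
  moreover have "(y1 = z1 + 1 \<and> y2 = z2) \<or> (y1 = z1 + 1 \<and> y2 = z2 - 1) \<or> (y1 = z1 \<and> y2 = z2 - 1) \<or>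
    (y1 = z1 - 1 \<and> y2 = z2) \<or> (y1 = z1 - 1 \<and> y2 = z2 + 1) \<or> (y1 = z1 \<and> y2 = z2 + 1)"
    using assms(2) by (simp add: adj_coord e)
  moreover have "(z1,z2) \<noteq> (s1,s2)" "(z1,z2) \<noteq> (t1,t2)" "(y1,y2) \<noteq> (s1,s2)" "(y1,y2) \<noteq> (t1,t2)"
    using assms(3-) by (simp_all only: e not_False_eq_True)
  ultimately show ?thesis
    unfolding e cross_def angle_def fst_conv snd_conv of_bool_def
    by (elim disjE conjE; hypsubst; simp only: prod.inject; smt (z3))
qed

section \<open>Reachability inside a set and the outer face\<close>

definition reach :: "point set \<Rightarrow> point \<Rightarrow> point \<Rightarrow> bool" where
  "reach A = (\<lambda>x y. x \<in> A \<and> y \<in> A \<and> adj x y)\<^sup>*\<^sup>*"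

lemma reach_refl [simp]: "reach A x x"
  by (simp add: reach_def)

lemma reach_trans [trans]: "reach A x y \<Longrightarrow> reach A y z \<Longrightarrow> reach A x z"
  unfolding reach_def by (rule rtranclp_trans)

lemma reach_step: "x \<in> A \<Longrightarrow> y \<in> A \<Longrightarrow> adj x y \<Longrightarrow> reach A x y"
  unfolding reach_def by auto

lemma reach_induct [consumes 1, case_names base step]:
  assumes "reach A x y" "P x"
    and "\<And>y z. reach A x y \<Longrightarrow> y \<in> A \<Longrightarrow> z \<in> A \<Longrightarrow> adj y z \<Longrightarrow> P y \<Longrightarrow> P z"
  shows "P y"
  using assms unfolding reach_def by (rule rtranclp_induct) auto

lemma reach_mono: "reach A x y \<Longrightarrow> A \<subseteq> B \<Longrightarrow> reach B x y"
  by (induction rule: reach_induct) (auto intro: reach_trans reach_step)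

lemma reach_sym: "reach A x y \<Longrightarrow> reach A y x"
  by (induction rule: reach_induct) (auto intro: reach_trans reach_step adj_sym)

lemma reach_closed: "reach A x y \<Longrightarrow> x \<in> A \<Longrightarrow> y \<in> A"
  by (induction rule: reach_induct) auto

lemma connected_shape_iff: "connected_shape S \<longleftrightarrow> (\<forall>u\<in>S. \<forall>v\<in>S. reach S u v)"
  by (simp add: connected_shape_def reach_def)

lemma outer_face_iff: "q \<in> outer_face S \<longleftrightarrow> q \<notin> S \<and> infinite {r. reach (- S) q r}"
  by (simp add: outer_face_def reach_def)

text \<open>Shrinking the shape only enlarges complement components, so the component of
  \<open>q\<close> contains the infinite one of \<open>r\<close>.\<close>

lemma outer_face_reach:
  assumes "reach (- T) q r" "r \<in> outer_face S" "T \<subseteq> S" "q \<notin> T"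
  shows "q \<in> outer_face T"
proof -
  have "{s. reach (- S) r s} \<subseteq> {s. reach (- T) q s}"
    using assms(1,3) by (auto intro: reach_trans reach_mono)
  then show ?thesis
    using assms(2,4) by (auto simp: outer_face_iff dest: finite_subset)
qed

lemma hole_freeD: "hole_points S = {} \<Longrightarrow> q \<notin> S \<Longrightarrow> q \<in> outer_face S"
  by (cases q) (auto simp: hole_points_def)

section \<open>Straight rays and the uniqueness of the outer face\<close>

definition ray :: "point \<Rightarrow> nat \<Rightarrow> nat \<Rightarrow> point" where
  "ray q i n = (fst q + int n * fst (dir i), snd q + int n * snd (dir i))"

lemma ray_0 [simp]: "ray q i 0 = q"
  by (simp add: ray_def)

lemma ray_Suc: "ray q i (Suc n) = nbr (ray q i n) i"
  by (simp add: ray_def nbr_def algebra_simps)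

lemma adj_ray [simp]: "adj (ray q i n) (ray q i (Suc n))"
  by (simp add: ray_Suc)

lemma ray_inj: "ray q i m = ray q i n \<Longrightarrow> m = n"
  using dir_in[of i] by (auto simp: ray_def)

lemma reach_ray: "(\<And>m. m \<le> n \<Longrightarrow> ray q i m \<in> A) \<Longrightarrow> reach A q (ray q i n)"
proof (induction n)
  case (Suc n)
  then show ?case
    by (meson adj_ray le_Suc_eq order_refl reach_step reach_trans)
qed simp

lemma outer_face_ray:
  assumes "\<And>n. ray q i n \<notin> S"
  shows "q \<in> outer_face S"
proof -
  have "reach (- S) q (ray q i n)" for n
    by (rule reach_ray) (simp add: assms)
  then have "range (ray q i) \<subseteq> {r. reach (- S) q r}"
    by auto
  moreover have "infinite (range (ray q i))"
    by (meson finite_imageD infinite_UNIV_nat injI ray_inj)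
  ultimately show ?thesis
    using assms[of 0] by (auto simp: outer_face_iff dest: finite_subset)
qed

lemma reach_row:
  assumes "\<And>k. (k, y) \<in> A"
  shows "reach A (a, y) (b, y)"
proof -
  have *: "reach A (c, y) (c + int n, y)" for c n
    using reach_ray[of n "(c, y)" 0 A] assms by (simp add: ray_def)
  show ?thesis
    using *[of a "nat (b - a)"] reach_sym[OF *[of b "nat (a - b)"]] by (cases "a \<le> b") auto
qed

lemma reach_column:
  assumes "\<And>k. (x, k) \<in> A"
  shows "reach A (x, a) (x, b)"
proof -
  have *: "reach A (x, c) (x, c + int n)" for c n
    using reach_ray[of n "(x, c)" 5 A] assms by (simp add: ray_def)
  show ?thesis
    using *[of a "nat (b - a)"] reach_sym[OF *[of b "nat (a - b)"]] by (cases "a \<le> b") auto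
qed

lemma finite_shape_bound:
  fixes S :: "point set"
  assumes "finite S"
  obtains M where "\<And>s. s \<in> S \<Longrightarrow> \<bar>fst s\<bar> \<le> M \<and> \<bar>snd s\<bar> \<le> M"
proof -
  have "finite ((\<lambda>s. \<bar>fst s\<bar> + \<bar>snd s\<bar>) ` S)"
    using assms by simp
  then have "\<bar>fst s\<bar> + \<bar>snd s\<bar> \<le> Max ((\<lambda>s. \<bar>fst s\<bar> + \<bar>snd s\<bar>) ` S)" if "s \<in> S" for s
    using that by (intro Max_ge) auto
  then show thesis
    by (intro that[of "Max ((\<lambda>s. \<bar>fst s\<bar> + \<bar>snd s\<bar>) ` S)"]) fastforce
qed

text \<open>An infinite component must leave a bounding box of \<open>S\<close>; outside the box a
  whole row or a whole column misses \<open>S\<close>, and along these one reaches a fixed corner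
  \<open>h\<close> beyond the box.\<close>

lemma outer_face_connected:
  assumes "finite S" "p \<in> outer_face S" "q \<in> outer_face S"
  shows "reach (- S) p q"
proof -
  obtain M where M: "\<And>s. s \<in> S \<Longrightarrow> \<bar>fst s\<bar> \<le> M \<and> \<bar>snd s\<bar> \<le> M"
    using finite_shape_bound[OF assms(1)] by blast
  have free: "(a, b) \<in> - S" if "M < \<bar>a\<bar> \<or> M < \<bar>b\<bar>" for a b
    using that M[of "(a, b)"] by auto
  define h where "h = (\<bar>M\<bar> + 1, \<bar>M\<bar> + 1)"
  have far: "reach (- S) (a, b) h" if "M < \<bar>a\<bar> \<or> M < \<bar>b\<bar>" for a b
  proof (cases "M < \<bar>a\<bar>")
    case True
    have "reach (- S) (a, b) (a, \<bar>M\<bar> + 1)" "reach (- S) (a, \<bar>M\<bar> + 1) h"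
      unfolding h_def using True by (auto intro!: reach_column reach_row free)
    then show ?thesis by (rule reach_trans)
  next
    case False
    have "reach (- S) (a, b) (\<bar>M\<bar> + 1, b)" "reach (- S) (\<bar>M\<bar> + 1, b) h"
      unfolding h_def using False that by (auto intro!: reach_column reach_row free)
    then show ?thesis by (rule reach_trans)
  qed
  have "reach (- S) r h" if r: "r \<in> outer_face S" for r
  proof -
    have "finite ({-M..M} \<times> {-M..M})"
      by simp
    then have "\<not> {s. reach (- S) r s} \<subseteq> {-M..M} \<times> {-M..M}"
      using r by (meson finite_subset outer_face_iff)
    then obtain a b where "reach (- S) r (a, b)" "(a, b) \<notin> {-M..M} \<times> {-M..M}"
      unfolding subset_iff mem_Collect_eq by (metis surj_pair)
    moreover from this(2) have "M < \<bar>a\<bar> \<or> M < \<bar>b\<bar>"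
      by auto
    ultimately show ?thesis
      using far by (meson reach_trans)
  qed
  then show ?thesis
    using assms(2,3) reach_sym reach_trans by metis
qed

text \<open>Take for \<open>w z\<close> the crossing sum at \<open>z\<close> of a walk from
  \<open>p\<close> to \<open>q\<close> off \<open>S\<close>. By \<open>cross_diff\<close> its change
  between adjacent points of \<open>S\<close> depends on \<open>p\<close> and \<open>q\<close>
  only.\<close>

lemma ex_potential:
  assumes "reach (- S) p q"
  shows "\<exists>w. \<forall>z\<in>S. \<forall>z'\<in>S. adj z z' \<longrightarrow> w z' - w z = angle q z z' - angle p z z'"
  using assms
proof (induction rule: reach_induct)
  case base
  show ?case by (rule exI[of _ "\<lambda>_. 0"]) simp
next
  case (step y t)
  then obtain w where w: "\<And>z z'. z \<in> S \<Longrightarrow> z' \<in> S \<Longrightarrow> adj z z' \<Longrightarrow> w z' - w z = angle y z z' - angle p z z'"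
    by blast
  have "(w z' + cross y t z') - (w z + cross y t z) = angle t z z' - angle p z z'"
    if "z \<in> S" "z' \<in> S" "adj z z'" for z z'
    using w[OF that] cross_diff[of y t z z'] step(2-4) that by (cases "z = y \<or> z = t \<or> z' = y \<or> z' = t") auto
  then show ?case
    by (intro exI[of _ "\<lambda>z. w z + cross y t z"]) blast
qed

text \<open>Evaluates the difference of the winding numbers at \<open>b\<close> and \<open>a\<close>
  of a closed walk that leads from \<open>p\<close> to \<open>q\<close> and returns through
  \<open>x\<close>, computed along the step from \<open>a\<close> over \<open>x\<close> to
  \<open>b\<close>. It is nonzero because \<open>a\<close>, \<open>p\<close>, \<open>b\<close>,
  \<open>q\<close> alternate around \<open>x\<close>; only finitely many positions and directions
  have to be checked.\<close>

lemma winding_jump: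
  fixes x :: point and i :: nat
  assumes "0 < j" "j < n" "n < j'" "j' < 6"
  defines "a \<equiv> around x i True 0" and "p \<equiv> around x i True j"
    and "b \<equiv> around x i True n" and "q \<equiv> around x i True j'"
  shows "angle q a x - angle p a x + angle q x b - angle p x b
     + cross q x b + cross x p b - cross q x a - cross x p a \<noteq> 0"
proof -
  have "(j, n, j') \<in> {(1,2,3),(1,2,4),(1,2,5),(1,3,4),(1,3,5),(1,4,5),(2,3,4),(2,3,5),(2,4,5),(3,4,5)}"
    using assms(1-4) by simp presburger
  moreover obtain e1 e2 f g :: int where "(e1, e2) \<in> {(1,0),(1,-1),(0,-1),(-1,0),(-1,1),(0,1)}"
    and "(f, g) = (if True then (e1 + e2, - e1) else (- e2, e1 + e2))" and eqs:
    "around x i True 0 = (fst x + e1, snd x + e2)"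
    "around x i True 1 = (fst x + f, snd x + g)"
    "around x i True 2 = (fst x + (f - e1), snd x + (g - e2))"
    "around x i True 3 = (fst x + - e1, snd x + - e2)"
    "around x i True 4 = (fst x + - f, snd x + - g)"
    "around x i True 5 = (fst x + (e1 - f), snd x + (e2 - g))"
    by (rule around_coord)
  ultimately show ?thesis
    unfolding a_def p_def b_def q_def
    by (simp only: if_True prod.inject) (elim insertE emptyE conjE Pair_inject; hypsubst; simp only: eqs; simp add: angle_def cross_def)
qed

text \<open>Without holes, \<open>p\<close> and \<open>q\<close> are joined by a walk off
  \<open>S\<close>; closed up through \<open>x\<close>, it meets \<open>S\<close> in
  \<open>x\<close> only. Its winding number is therefore constant along walks in
  \<open>S - {x}\<close>, yet differs at \<open>a\<close> and \<open>b\<close>.\<close>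

lemma separated:
  assumes S: "finite S" "hole_points S = {}" and x: "x \<in> S"
    and offs: "0 < j" "j < n" "n < j'" "j' < 6"
    and out: "around x i True j \<notin> S" "around x i True j' \<notin> S"
    and ins: "around x i True 0 \<in> S" "around x i True n \<in> S"
  shows "\<not> reach (S - {x}) (around x i True 0) (around x i True n)"
proof
  define a p b q where [simp]: "a = around x i True 0" "p = around x i True j"
    "b = around x i True n" "q = around x i True j'"
  assume "reach (S - {x}) (around x i True 0) (around x i True n)"
  then have ab: "reach (S - {x}) a b" by simp
  have "p \<in> outer_face S" "q \<in> outer_face S"
    using S(2) out by (auto intro: hole_freeD)
  then have "reach (- S) p q"
    using S(1) outer_face_connected by blast
  from ex_potential[OF this] obtain w where
    w: "\<And>z z'. z \<in> S \<Longrightarrow> z' \<in> S \<Longrightarrow> adj z z' \<Longrightarrow> w z' - w z = angle q z z' - angle p z z'"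
    by blast
  \<comment> \<open>The winding number at \<open>z\<close> of the closed walk: \<open>w\<close>
    accounts for the part from \<open>p\<close> to \<open>q\<close>, the two crossings for the
    return through \<open>x\<close>.\<close>
  define W where "W z = w z + cross q x z + cross x p z" for z
  have const: "W z' = W z" if "z \<in> S - {x}" "z' \<in> S - {x}" "adj z z'" for z z'
  proof -
    have "z \<noteq> p" "z \<noteq> q" "z' \<noteq> p" "z' \<noteq> q"
      using that out by auto
    then show ?thesis
      using w[of z z'] cross_diff[of q x z z'] cross_diff[of x p z z'] that
      unfolding W_def by (auto simp del: One_nat_def)
  qed
  have "W y = W a" if "reach (S - {x}) a y" for y
    using that
  proof (induction rule: reach_induct)
    case (step y z)
    then show ?case using const[of y z] by simp
  qed simp
  then have "W b = W a" using ab by blast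
  moreover have "w x - w a = angle q a x - angle p a x" "w b - w x = angle q x b - angle p x b"
    using ins x w[of a x] w[of x b] by simp_all
  ultimately show False
    using winding_jump[OF offs, of x i] unfolding W_def by simp
qed

section \<open>Strictly convex erodable points\<close>

lemma local_boundaryI:
  assumes v: "v \<in> S" and l: "1 \<le> l" "l \<le> 6"
    and out: "\<And>j. j < l \<Longrightarrow> nbr v (i + j) \<notin> S"
    and ends: "l < 6 \<Longrightarrow> nbr v (i + 5) \<in> S \<and> nbr v (i + l) \<in> S"
  shows "\<exists>B. local_boundary S v B \<and> boundary_count B = int l - 2"
proof -
  have m: "nbr v ((i mod 6 + j) mod 6) = nbr v (i + j)" for j
    by (simp only: mod_add_left_eq nbr_mod)
  define B where "B = {(i mod 6 + j) mod 6 | j. j < l}"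
  have "boundary_point S v"
    unfolding boundary_point_def
    using v l(1) out[of 0] by (intro conjI exI[of _ "i mod 6"]) auto
  moreover have "\<forall>j<l. nbr v ((i mod 6 + j) mod 6) \<notin> S"
    using out by (simp only: m) blast
  moreover have "l < 6 \<longrightarrow> nbr v ((i mod 6 + 5) mod 6) \<in> S \<and> nbr v ((i mod 6 + l) mod 6) \<in> S"
    using ends unfolding m by blast
  moreover have "i mod 6 < 6"
    by simp
  ultimately have "local_boundary S v B"
    unfolding local_boundary_def B_def using l by blast
  moreover have "card B = l"
  proof -
    have B: "B = (\<lambda>j. (i mod 6 + j) mod 6) ` {..<l}"
      by (auto simp: B_def)
    have "inj_on (\<lambda>j. (i mod 6 + j) mod 6) {..<l}"
    proof (rule inj_onI)
      fix j k
      assume jk: "j \<in> {..<l}" "k \<in> {..<l}" "(i mod 6 + j) mod 6 = (i mod 6 + k) mod 6"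
      then have "around v i True j = around v i True k"
        by (simp add: around_def) (metis m)
      then show "j = k"
        using jk(1,2) l(2) by (subst (asm) around_inj) auto
    qed
    then show ?thesis
      by (simp add: B card_image)
  qed
  ultimately show ?thesis
    by (auto simp: boundary_count_def)
qed

text \<open>Three consecutive missing neighbours extend to a maximal interval of at least three
  edges; which of the other three neighbours are present decides its start and length.\<close>

lemma local_boundary_of_gap:
  assumes "v \<in> S" "nbr v k \<notin> S" "nbr v (k + 1) \<notin> S" "nbr v (k + 2) \<notin> S"
  shows "\<exists>B. local_boundary S v B \<and> boundary_count B > 0"
proof -
  have run: "\<exists>B. local_boundary S v B \<and> boundary_count B > 0"
    if "3 \<le> l" "l \<le> 6" "\<forall>j<l. nbr v (i + j) \<notin> S"
      "l < 6 \<longrightarrow> nbr v (i + 5) \<in> S \<and> nbr v (i + l) \<in> S" for i l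
    using local_boundaryI[of v S l i] that assms(1) by fastforce
  have small: "j < 3 \<longleftrightarrow> j = 0 \<or> j = 1 \<or> j = 2" "j < 4 \<longleftrightarrow> j = 0 \<or> j = 1 \<or> j = 2 \<or> j = 3"
    "j < 5 \<longleftrightarrow> j = 0 \<or> j = 1 \<or> j = 2 \<or> j = 3 \<or> j = 4" for j :: nat
    by auto
  have all: "(\<forall>j<3. Q j) \<longleftrightarrow> Q 0 \<and> Q 1 \<and> Q 2" "(\<forall>j<4. Q j) \<longleftrightarrow> Q 0 \<and> Q 1 \<and> Q 2 \<and> Q 3"
    "(\<forall>j<5. Q j) \<longleftrightarrow> Q 0 \<and> Q 1 \<and> Q 2 \<and> Q 3 \<and> Q 4"
    "(\<forall>j<6. Q j) \<longleftrightarrow> Q 0 \<and> Q 1 \<and> Q 2 \<and> Q 3 \<and> Q 4 \<and> Q 5" for Q :: "nat \<Rightarrow> bool"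
    unfolding small less6_iff by blast+
  have w5': "k + 5 + 0 = k + 5" "k + 5 + 1 = k + 6" "k + 5 + 2 = k + 7" "k + 5 + 3 = k + 8" "k + 5 + 4 = k + 9" "k + 5 + 5 = k + 10"
    by simp_all
  have w5: "nbr v (k + 5 + 0) = nbr v (k + 5)" "nbr v (k + 5 + 1) = nbr v k" "nbr v (k + 5 + 2) = nbr v (k + 1)"
    "nbr v (k + 5 + 3) = nbr v (k + 2)" "nbr v (k + 5 + 4) = nbr v (k + 3)" "nbr v (k + 5 + 5) = nbr v (k + 4)"
    by (simp_all only: w5' nbr_add6)
  have w4': "k + 4 + 0 = k + 4" "k + 4 + 1 = k + 5" "k + 4 + 2 = k + 6" "k + 4 + 3 = k + 7" "k + 4 + 4 = k + 8" "k + 4 + 5 = k + 9"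
    by simp_all
  have w4: "nbr v (k + 4 + 0) = nbr v (k + 4)" "nbr v (k + 4 + 1) = nbr v (k + 5)" "nbr v (k + 4 + 2) = nbr v k"
    "nbr v (k + 4 + 3) = nbr v (k + 1)" "nbr v (k + 4 + 4) = nbr v (k + 2)" "nbr v (k + 4 + 5) = nbr v (k + 3)"
    by (simp_all only: w4' nbr_add6)
  show ?thesis
  proof (cases "nbr v (k + 3) \<in> S"; cases "nbr v (k + 4) \<in> S"; cases "nbr v (k + 5) \<in> S")
    assume *: "nbr v (k + 3) \<in> S" "nbr v (k + 4) \<in> S" "nbr v (k + 5) \<in> S"
    show ?thesis using run[of 3 k] * assms unfolding all w4 w5 add_0_right by simp
  next
    assume *: "nbr v (k + 3) \<in> S" "nbr v (k + 4) \<in> S" "nbr v (k + 5) \<notin> S"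
    show ?thesis using run[of 4 "k + 5"] * assms unfolding all w4 w5 add_0_right by simp
  next
    assume *: "nbr v (k + 3) \<in> S" "nbr v (k + 4) \<notin> S" "nbr v (k + 5) \<in> S"
    show ?thesis using run[of 3 k] * assms unfolding all w4 w5 add_0_right by simp
  next
    assume *: "nbr v (k + 3) \<in> S" "nbr v (k + 4) \<notin> S" "nbr v (k + 5) \<notin> S"
    show ?thesis using run[of 5 "k + 4"] * assms unfolding all w4 w5 add_0_right by simp
  next
    assume *: "nbr v (k + 3) \<notin> S" "nbr v (k + 4) \<in> S" "nbr v (k + 5) \<in> S"
    show ?thesis using run[of 4 k] * assms unfolding all w4 w5 add_0_right by simp
  next
    assume *: "nbr v (k + 3) \<notin> S" "nbr v (k + 4) \<in> S" "nbr v (k + 5) \<notin> S"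
    show ?thesis using run[of 5 "k + 5"] * assms unfolding all w4 w5 add_0_right by simp
  next
    assume *: "nbr v (k + 3) \<notin> S" "nbr v (k + 4) \<notin> S" "nbr v (k + 5) \<in> S"
    show ?thesis using run[of 5 k] * assms unfolding all w4 w5 add_0_right by simp
  next
    assume *: "nbr v (k + 3) \<notin> S" "nbr v (k + 4) \<notin> S" "nbr v (k + 5) \<notin> S"
    show ?thesis using run[of 6 k] * assms unfolding all w4 w5 add_0_right by simp
  qed
qed

lemma gap_of_local_boundary:
  assumes "local_boundary S v B" "boundary_count B > 0"
  obtains k where "nbr v k \<notin> S" "nbr v (k + 1) \<notin> S" "nbr v (k + 2) \<notin> S"
proof -
  obtain i l where B: "B = {(i + j) mod 6 | j. j < l}" and out: "\<forall>j<l. nbr v ((i + j) mod 6) \<notin> S"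
    using assms(1) unfolding local_boundary_def by blast
  have "B = (\<lambda>j. (i + j) mod 6) ` {..<l}"
    by (auto simp: B)
  then have "card B \<le> l"
    using card_image_le[of "{..<l}"] by simp
  then have "2 < l"
    using assms(2) by (simp add: boundary_count_def)
  then have "nbr v (i + 0) \<notin> S" "nbr v (i + 1) \<notin> S" "nbr v (i + 2) \<notin> S"
    using out[unfolded nbr_mod] by (auto simp del: One_nat_def add_Suc_right)
  then show thesis
    by (intro that[of i]) simp_all
qed

text \<open>In a hole-free shape every missing point lies in the outer face, so membership in the
  outer boundary comes for free, and a positive count just means three consecutive missing
  neighbours.\<close>

lemma SCE_iff:
  assumes "hole_points S = {}"
  shows "SCE S v \<longleftrightarrow> redundant S v \<and> (\<exists>k. nbr v k \<notin> S \<and> nbr v (k + 1) \<notin> S \<and> nbr v (k + 2) \<notin> S)"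
proof
  assume "SCE S v"
  then obtain B where "redundant S v" "local_boundary S v B" "boundary_count B > 0"
    unfolding SCE_def erodable_def by blast
  then show "redundant S v \<and> (\<exists>k. nbr v k \<notin> S \<and> nbr v (k + 1) \<notin> S \<and> nbr v (k + 2) \<notin> S)"
    using gap_of_local_boundary by metis
next
  assume "redundant S v \<and> (\<exists>k. nbr v k \<notin> S \<and> nbr v (k + 1) \<notin> S \<and> nbr v (k + 2) \<notin> S)"
  then obtain k where r: "redundant S v" and k: "nbr v k \<notin> S" "nbr v (k + 1) \<notin> S" "nbr v (k + 2) \<notin> S"
    by blast
  have v: "v \<in> S"
    using r by (simp add: redundant_def)
  have "nbr v (k mod 6) \<in> outer_face S"
    using hole_freeD[OF assms] k(1) by simp
  then have "v \<in> outer_boundary S"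
    unfolding outer_boundary_def using v
    by (intro CollectI conjI exI[of _ "k mod 6"] bexI) auto
  then show "SCE S v"
    unfolding SCE_def erodable_def using r local_boundary_of_gap[OF v k] by blast
qed

lemma around_gap:
  assumes "around v i r 3 \<notin> S" "around v i r 4 \<notin> S" "around v i r 5 \<notin> S"
  shows "\<exists>k. nbr v k \<notin> S \<and> nbr v (k + 1) \<notin> S \<and> nbr v (k + 2) \<notin> S"
proof (cases r)
  case True
  have eqs: "i + 3 + 1 = i + 4" "i + 3 + 2 = i + 5"
    by simp_all
  from True show ?thesis
    using assms eqs by (intro exI[of _ "i + 3"]) (simp only: around_def if_True not_False_eq_True)
next
  case False
  have eqs: "i + 5 * 3 = i + 9 + 6" "i + 5 * 4 = i + 8 + 6 + 6" "i + 5 * 5 = i + 7 + 6 + 6 + 6"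
    by simp_all
  have "around v i r 3 = nbr v (i + 3)" "around v i r 4 = nbr v (i + 2)" "around v i r 5 = nbr v (i + 1)"
    using False by (simp_all only: around_def if_False eqs nbr_add6)
  then show ?thesis
    using assms by (intro exI[of _ "i + 1"]) (simp add: add.assoc numeral_eq_Suc)
qed

text \<open>The possible neighbours form a path of three points, which is disconnected only when
  both ends are present without the middle.\<close>

lemma redundant_around:
  assumes "v \<in> S" and gap: "around v i r 3 \<notin> S" "around v i r 4 \<notin> S" "around v i r 5 \<notin> S"
  shows "redundant S v \<longleftrightarrow> (around v i r 0 \<in> S \<and> around v i r 2 \<in> S \<longrightarrow> around v i r 1 \<in> S)"
proof -
  define N where "N = {u. u \<in> S \<and> adj v u}"
  define a m b where [simp]: "a = around v i r 0" "m = around v i r 1" "b = around v i r 2"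
  have ad: "adj a m" "adj m b" "\<not> adj a b" "a \<noteq> b" "adj m a" "adj b m"
    by (simp_all add: adj_around around_inj del: One_nat_def)
  have N: "u \<in> N \<longleftrightarrow> u \<in> S \<and> (u = a \<or> u = m \<or> u = b)" for u
  proof
    assume "u \<in> N"
    then have "adj v u" "u \<in> S" by (simp_all add: N_def)
    then obtain k where "k < 6" "u = around v i r k" by (meson adj_aroundE)
    then show "u \<in> S \<and> (u = a \<or> u = m \<or> u = b)"
      using \<open>u \<in> S\<close> gap unfolding less6_iff by (elim disjE) simp_all
  next
    assume "u \<in> S \<and> (u = a \<or> u = m \<or> u = b)"
    then show "u \<in> N" by (auto simp: N_def)
  qed
  have "connected_shape N \<longleftrightarrow> (a \<in> S \<and> b \<in> S \<longrightarrow> m \<in> S)"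
  proof
    assume c: "connected_shape N"
    show "a \<in> S \<and> b \<in> S \<longrightarrow> m \<in> S"
    proof (rule ccontr)
      assume "\<not> (a \<in> S \<and> b \<in> S \<longrightarrow> m \<in> S)"
      then have *: "a \<in> S" "b \<in> S" "m \<notin> S" by auto
      then have "reach N a b"
        using c N by (simp add: connected_shape_iff)
      moreover have "y = a" if "reach N a y" for y
        using that
      proof (induction rule: reach_induct)
        case (step y z)
        then show ?case using N * ad by auto
      qed simp
      ultimately show False using ad(4) by blast
    qed
  next
    assume imp: "a \<in> S \<and> b \<in> S \<longrightarrow> m \<in> S"
    show "connected_shape N"
      unfolding connected_shape_iff
    proof (intro ballI)
      fix u w
      assume uw: "u \<in> N" "w \<in> N"
      show "reach N u w"
      proof (cases "m \<in> S")
        case True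
        then have m: "m \<in> N" by (simp add: N)
        have "reach N u m" "reach N m w"
          using uw m ad N by (metis reach_refl reach_step)+
        then show ?thesis by (rule reach_trans)
      next
        case False
        then have "u = w" using uw imp N by metis
        then show ?thesis by simp
      qed
    qed
  qed
  then show ?thesis
    using assms(1) by (simp add: redundant_def N_def)
qed

lemma SCE_around:
  assumes "hole_points S = {}" "v \<in> S" "around v i r 3 \<notin> S" "around v i r 4 \<notin> S" "around v i r 5 \<notin> S"
    and "around v i r 0 \<in> S \<Longrightarrow> around v i r 2 \<in> S \<Longrightarrow> around v i r 1 \<in> S"
  shows "SCE S v"
  using assms around_gap[of v i r S] redundant_around[of v S i r] SCE_iff by blast

lemma SCE_aroundE:
  assumes "hole_points S = {}" "SCE S v"
  obtains i where "v \<in> S" "around v i True 3 \<notin> S" "around v i True 4 \<notin> S" "around v i True 5 \<notin> S"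
    "around v i True 0 \<in> S \<Longrightarrow> around v i True 2 \<in> S \<Longrightarrow> around v i True 1 \<in> S"
proof -
  from assms obtain k where r: "redundant S v" and k: "nbr v k \<notin> S" "nbr v (k + 1) \<notin> S" "nbr v (k + 2) \<notin> S"
    using SCE_iff by blast
  have v: "v \<in> S" using r by (simp add: redundant_def)
  \<comment> \<open>Starting opposite to the gap moves it to the positions 3, 4, 5 and leaves the
    possible neighbours at 0, 1, 2, the normal form used below.\<close>
  have eqs: "k + 3 + 3 = k + 6" "k + 3 + 4 = k + 7" "k + 3 + 5 = k + 8"
    by simp_all
  have "around v (k + 3) True 3 \<notin> S" "around v (k + 3) True 4 \<notin> S" "around v (k + 3) True 5 \<notin> S"
    using k by (simp_all only: around_def if_True eqs nbr_add6 not_False_eq_True)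
  then show thesis
    using r v redundant_around[of v S "k + 3" True] by (intro that[of "k + 3"]) blast+
qed

text \<open>Reflection in the axis through the positions 1 and 4. It reduces a mirrored
  configuration to one already treated.\<close>

lemma around_flip:
  "around v i True 0 = around v (i + 2) False 2" "around v i True 1 = around v (i + 2) False 1"
  "around v i True 2 = around v (i + 2) False 0" "around v i True 3 = around v (i + 2) False 5"
  "around v i True 4 = around v (i + 2) False 4" "around v i True 5 = around v (i + 2) False 3"
proof -
  have eqs: "i + 2 + 5 * 0 = i + 2" "i + 2 + 5 * 1 = i + 1 + 6" "i + 2 + 5 * 2 = i + 6 + 6" "i + 2 + 5 * 3 = i + 5 + 6 + 6"
    "i + 2 + 5 * 4 = i + 4 + 6 + 6 + 6" "i + 2 + 5 * 5 = i + 3 + 6 + 6 + 6 + 6"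
    by simp_all
  show "around v i True 0 = around v (i + 2) False 2" "around v i True 1 = around v (i + 2) False 1"
    "around v i True 2 = around v (i + 2) False 0" "around v i True 3 = around v (i + 2) False 5"
    "around v i True 4 = around v (i + 2) False 4" "around v i True 5 = around v (i + 2) False 3"
    by (simp_all only: around_def if_True if_False eqs nbr_add6 add_0_right)
qed

section \<open>Simply connected shapes\<close>

definition simply_connected :: "point set \<Rightarrow> bool" where
  "simply_connected S \<longleftrightarrow> finite S \<and> connected_shape S \<and> hole_points S = {}"

lemma hole_freeI: "(\<And>q. q \<notin> S \<Longrightarrow> q \<in> outer_face S) \<Longrightarrow> hole_points S = {}"
  by (auto simp: hole_points_def)

text \<open>A walk through \<open>v\<close> enters and leaves by neighbours of \<open>v\<close>, and
  these are connected among themselves without \<open>v\<close>.\<close>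

lemma connected_remove:
  assumes "connected_shape S" "redundant S v"
  shows "connected_shape (S - {v})"
proof -
  have N: "reach (S - {v}) c y" if "c \<in> S" "adj v c" "y \<in> S" "adj v y" for c y
  proof -
    have "reach {u. u \<in> S \<and> adj v u} c y"
      using assms(2) that unfolding redundant_def connected_shape_iff by blast
    then show ?thesis
      by (rule reach_mono) auto
  qed
  have "reach (S - {v}) u w" if u: "u \<in> S" "u \<noteq> v" and w: "w \<in> S" "w \<noteq> v" for u w
  proof -
    have "reach S u w"
      using assms(1) u w by (simp add: connected_shape_iff)
    \<comment> \<open>The claim is strengthened for walks that currently stand on \<open>v\<close>:
      all neighbours of \<open>v\<close> are then already reachable without it.\<close>
    then have "if w = v then \<forall>c\<in>S. adj v c \<longrightarrow> reach (S - {v}) u c else reach (S - {v}) u w"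
    proof (induction rule: reach_induct)
      case (step y z)
      show ?case
      proof (cases "z = v")
        case True
        then have y: "y \<noteq> v" "adj v y" using step(4) adj_sym by auto
        then have "reach (S - {v}) u y" using step(5) by simp
        moreover have "reach (S - {v}) y c" if "c \<in> S" "adj v c" for c
          using N[OF step(2) y(2)] that by blast
        ultimately show ?thesis using True by (metis reach_trans)
      next
        case z: False
        show ?thesis
        proof (cases "y = v")
          case True
          then show ?thesis using step z by auto
        next
          case False
          then show ?thesis using step z reach_step[of y "S - {v}" z] by (auto intro: reach_trans)
        qed
      qed
    qed (use u in auto)
    then show ?thesis using w by simp
  qed
  then show ?thesis
    by (simp add: connected_shape_iff)
qed

text \<open>No hole arises, because the removed point has a neighbour in the outer face and joins
  that face.\<close>

lemma simply_connected_remove: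
  assumes "simply_connected S" "SCE S v"
  shows "simply_connected (S - {v})"
proof -
  have v: "redundant S v" "v \<in> outer_boundary S"
    using assms(2) by (auto simp: SCE_def erodable_def)
  have "q \<in> outer_face (S - {v})" if "q \<notin> S - {v}" for q
  proof (cases "q = v")
    case True
    obtain i where "nbr v i \<in> outer_face S"
      using v(2) by (auto simp: outer_boundary_def)
    then have "reach (- (S - {v})) q (nbr v i)"
      using True by (intro reach_step) (auto simp: outer_face_iff)
    from outer_face_reach[OF this, of S] show ?thesis
      using \<open>nbr v i \<in> outer_face S\<close> that by blast
  next
    case False
    then have "q \<in> outer_face S"
      using that assms(1) by (auto simp: simply_connected_def intro: hole_freeD)
    then show ?thesis
      using outer_face_reach[OF reach_refl, of q S "S - {v}"] that by blast
  qed
  then have "hole_points (S - {v}) = {}"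
    by (rule hole_freeI)
  then show ?thesis
    using assms(1) connected_remove[OF _ v(1)] by (simp add: simply_connected_def)
qed

section \<open>Existence of two SCE points\<close>

lemma exists_top_left:
  fixes S :: "point set"
  assumes "finite S" "S \<noteq> {}"
  shows "\<exists>v\<in>S. \<forall>s\<in>S. snd s < snd v \<or> snd s = snd v \<and> fst v \<le> fst s"
  using assms
proof (induction rule: finite_ne_induct)
  case (insert x F)
  then obtain v where v: "v \<in> F" "\<And>s. s \<in> F \<Longrightarrow> snd s < snd v \<or> snd s = snd v \<and> fst v \<le> fst s"
    by blast
  show ?case
  proof (cases "snd v < snd x \<or> snd v = snd x \<and> fst x \<le> fst v")
    case True
    have "snd s < snd x \<or> snd s = snd x \<and> fst x \<le> fst s" if "s \<in> insert x F" for s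
      using that True v(2)[of s] by auto
    then show ?thesis by blast
  next
    case False
    then show ?thesis using v by (intro bexI[of _ v]) auto
  qed
qed simp

lemma exists_bottom_right:
  fixes S :: "point set"
  assumes "finite S" "S \<noteq> {}"
  shows "\<exists>v\<in>S. \<forall>s\<in>S. snd v < snd s \<or> snd s = snd v \<and> fst s \<le> fst v"
proof -
  have "finite ((\<lambda>s. (- fst s, - snd s)) ` S)" "(\<lambda>s. (- fst s, - snd s)) ` S \<noteq> {}"
    using assms by auto
  from exists_top_left[OF this] obtain v where "v \<in> S"
    "\<And>s. s \<in> S \<Longrightarrow> - snd s < - snd v \<or> - snd s = - snd v \<and> - fst v \<le> - fst s"
    by (simp only: bex_simps ball_simps fst_conv snd_conv) blast
  then show ?thesis
    by (intro bexI[of _ v]) auto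
qed

lemma two_SCE_if_all_redundant:
  assumes S: "simply_connected S" "2 \<le> card S" and red: "\<And>x. x \<in> S \<Longrightarrow> redundant S x"
  shows "\<exists>u v. u \<noteq> v \<and> SCE S u \<and> SCE S v"
proof -
  have fin: "finite S" "S \<noteq> {}" "hole_points S = {}"
    using S by (auto simp: simply_connected_def)
  obtain v where v: "v \<in> S" "\<And>s. s \<in> S \<Longrightarrow> snd s < snd v \<or> snd s = snd v \<and> fst v \<le> fst s"
    using exists_top_left[OF fin(1,2)] by blast
  obtain u where u: "u \<in> S" "\<And>s. s \<in> S \<Longrightarrow> snd u < snd s \<or> snd s = snd u \<and> fst s \<le> fst u"
    using exists_bottom_right[OF fin(1,2)] by blast
  \<comment> \<open>Three consecutive directions lead lexicographically beyond an extreme point, so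
    redundancy is all it needs to be SCE.\<close>
  have "nbr v 3 \<notin> S" "nbr v (3 + 1) \<notin> S" "nbr v (3 + 2) \<notin> S"
    using v(2)[of "nbr v 3"] v(2)[of "nbr v 4"] v(2)[of "nbr v 5"] by (auto simp: nbr_def)
  moreover have "nbr u 0 \<notin> S" "nbr u (0 + 1) \<notin> S" "nbr u (0 + 2) \<notin> S"
    unfolding add_0
    using u(2)[of "nbr u 0"] u(2)[of "nbr u 1"] u(2)[of "nbr u 2"] by (auto simp: nbr_def)
  ultimately have "SCE S u" "SCE S v"
    using red u(1) v(1) SCE_iff[OF fin(3)] by blast+
  moreover have "u \<noteq> v"
  proof
    assume "u = v"
    then have "s = v" if "s \<in> S" for s
      using u(2)[OF that] v(2)[OF that] by (auto simp: prod_eq_iff)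
    then have "card S \<le> card {v}"
      by (intro card_mono) auto
    then show False using S(2) by simp
  qed
  ultimately show ?thesis by blast
qed

text \<open>A branch at \<open>x\<close> together with \<open>x\<close> inherits the hypotheses for
  an induction. Its points have the same neighbours in the branch and in \<open>S\<close>, so SCE
  points other than \<open>x\<close> transfer back. For holes, follow from a missing point a ray
  that avoids \<open>x\<close>; opposite rays cannot both contain \<open>x\<close>. The last point
  before the branch is not in \<open>S\<close>, otherwise it would belong to the branch, so it is an
  outer point.\<close>

lemma component_with_center:
  assumes S: "simply_connected S" and x: "x \<in> S" and a: "a \<in> S" "adj x a"
  defines "C \<equiv> {y. reach (S - {x}) a y}"
  shows "simply_connected (insert x C)"
    and "v \<in> C \<Longrightarrow> SCE (insert x C) v \<Longrightarrow> SCE S v"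
proof -
  have C: "C \<subseteq> S - {x}"
    using a adj_irrefl reach_closed[of "S - {x}" a] unfolding C_def by blast
  have "a \<in> C" by (simp add: C_def)
  have step: "z \<in> C" if "y \<in> C" "adj y z" "z \<in> S" "z \<noteq> x" for y z
    using that C reach_step[of y "S - {x}" z] unfolding C_def by (auto intro: reach_trans)
  define T where "T = insert x C"
  have T: "T \<subseteq> S" using C x by (auto simp: T_def)
  have "connected_shape T"
  proof -
    have C_reach: "y \<in> C \<and> reach C a y" if "reach (S - {x}) a y" for y
      using that
    proof (induction rule: reach_induct)
      case (step y z)
      then have "z \<in> C" using \<open>\<And>y z. y \<in> C \<Longrightarrow> adj y z \<Longrightarrow> z \<in> S \<Longrightarrow> z \<noteq> x \<Longrightarrow> z \<in> C\<close> by blast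
      then show ?case using step by (auto intro: reach_trans reach_step)
    qed (simp add: \<open>a \<in> C\<close>)
    have "reach T y a" if "y \<in> T" for y
    proof (cases "y = x")
      case True
      then show ?thesis using a \<open>a \<in> C\<close> by (auto intro!: reach_step simp: T_def)
    next
      case False
      then have "reach C a y" using that C_reach by (auto simp: T_def C_def)
      then have "reach C y a" by (rule reach_sym)
      then show ?thesis by (rule reach_mono) (auto simp: T_def)
    qed
    then show ?thesis
      unfolding connected_shape_iff by (meson reach_sym reach_trans)
  qed
  moreover have holes: "hole_points T = {}"
  proof (rule hole_freeI)
    fix q assume q: "q \<notin> T"
    have out: "q \<in> outer_face T" if "reach (- T) q r" "r \<notin> S" for r
      using outer_face_reach[OF that(1) _ T q] hole_freeD[of S r] S that(2)
      by (simp add: simply_connected_def)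
    have "\<exists>i. \<forall>n. ray q i n \<noteq> x"
    proof (rule ccontr)
      assume *: "\<not> ?thesis"
      then obtain m n where "ray q 0 m = x" "ray q 3 n = x" by blast
      then have "m = 0 \<and> q = x" by (auto simp: ray_def)
      then show False using q by (simp add: T_def)
    qed
    then obtain i where i: "\<And>n. ray q i n \<noteq> x" by blast
    show "q \<in> outer_face T"
    proof (cases "\<forall>n. ray q i n \<notin> T")
      case True
      then show ?thesis by (intro outer_face_ray[of q i]) auto
    next
      case False
      define n where "n = (LEAST n. ray q i n \<in> T)"
      have n: "ray q i n \<in> T" "\<And>m. m < n \<Longrightarrow> ray q i m \<notin> T"
        using False LeastI_ex[of "\<lambda>n. ray q i n \<in> T"] not_less_Least[of _ "\<lambda>n. ray q i n \<in> T"]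
        unfolding n_def by blast+
      have "n \<noteq> 0" using n(1) q by (metis ray_0)
      then obtain m where m: "n = Suc m" by (cases n) auto
      have "ray q i (Suc m) \<in> C"
        using n(1) i m by (auto simp: T_def)
      moreover have "ray q i m \<notin> C"
        using n(2)[of m] m by (auto simp: T_def)
      ultimately have "ray q i m \<notin> S"
        using step[of "ray q i (Suc m)" "ray q i m"] i adj_ray adj_sym by blast
      moreover have "reach (- T) q (ray q i m)"
        by (rule reach_ray) (use n(2) m in auto)
      ultimately show ?thesis using out by blast
    qed
  qed
  ultimately show "simply_connected (insert x C)"
    using S T by (auto simp: simply_connected_def T_def intro: finite_subset)
  assume v: "v \<in> C" "SCE (insert x C) v"
  have nb: "u \<in> T \<longleftrightarrow> u \<in> S" if "adj v u" for u
    using step[OF v(1) that] T by (auto simp: T_def)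
  have "{u. u \<in> T \<and> adj v u} = {u. u \<in> S \<and> adj v u}"
    using nb by blast
  moreover have "redundant T v" "\<exists>k. nbr v k \<notin> T \<and> nbr v (k + 1) \<notin> T \<and> nbr v (k + 2) \<notin> T"
    using v(2) SCE_iff[OF holes] by (simp_all add: T_def)
  ultimately show "SCE S v"
    using SCE_iff[of S v] S T nb[OF adj_nbr] unfolding redundant_def simply_connected_def by auto
qed

lemma arc_reach:
  assumes "k \<le> n" "n < 6" "\<And>j. k \<le> j \<Longrightarrow> j \<le> n \<Longrightarrow> around x i True j \<in> S"
  shows "reach {u. u \<in> S \<and> adj x u} (around x i True k) (around x i True n)"
  using assms
proof (induction n rule: dec_induct)
  case (step n)
  have "adj (around x i True n) (around x i True (Suc n))"
    using step.prems(1) by (subst adj_around) auto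
  then show ?case
    using step by (intro reach_trans[OF step.IH] reach_step) auto
qed simp

lemma two_SCE:
  assumes "simply_connected S" "2 \<le> card S"
  shows "\<exists>u v. u \<noteq> v \<and> SCE S u \<and> SCE S v"
  using assms
proof (induction "card S" arbitrary: S rule: less_induct)
  case less
  show ?case
  proof (cases "\<forall>x\<in>S. redundant S x")
    case True
    then show ?thesis using two_SCE_if_all_redundant less.prems by blast
  next
    case False
    then obtain x where x: "x \<in> S" "\<not> redundant S x" by blast
    have S: "finite S" "hole_points S = {}"
      using less.prems by (auto simp: simply_connected_def)
    define N where "N = {u. u \<in> S \<and> adj x u}"
    obtain a b where ab: "a \<in> N" "b \<in> N" "\<not> reach N a b"
      using x unfolding redundant_def connected_shape_iff N_def by blast
    obtain i where i: "a = around x i True 0"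
      using ab(1) by (auto simp: N_def around_def adj_iff)
    obtain n where n: "n < 6" "b = around x i True n"
      using ab(2) adj_aroundE[of x b] unfolding N_def by blast
    have "n \<noteq> 0" using ab(3) n i by (metis reach_refl)
    \<comment> \<open>Each of the two arcs of the hexagon between \<open>a\<close> and
      \<open>b\<close> has a missing point, otherwise that arc would connect them inside
      \<open>N\<close>.\<close>
    obtain j where j: "j \<le> n" "around x i True j \<notin> S"
      using arc_reach[of 0 n x i S] ab(3) n i unfolding N_def by blast
    obtain j' where j': "n \<le> j'" "j' \<le> 5" "around x i True j' \<notin> S"
    proof (rule ccontr)
      assume "\<not> thesis"
      then have in_S: "\<And>j. n \<le> j \<Longrightarrow> j \<le> 5 \<Longrightarrow> around x i True j \<in> S"
        using that by blast
      then have "reach N b (around x i True 5)"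
        using arc_reach[of n 5 x i S] n unfolding N_def by auto
      moreover have "reach N (around x i True 5) a"
        using in_S[of 5] n ab(1) i by (intro reach_step) (auto simp: N_def adj_around)
      ultimately show False
        using ab(3) reach_sym reach_trans by metis
    qed
    have "around x i True 0 \<in> S" "around x i True n \<in> S"
      using ab(1,2) i n(2) by (simp_all add: N_def)
    then have ne: "j \<noteq> 0" "j \<noteq> n" "j' \<noteq> n"
      using j(2) j'(3) by metis+
    have sep: "\<not> reach (S - {x}) a b"
      unfolding i n(2)
      by (rule separated[of S x j n j' i]) (use S x j j' n ab ne in \<open>auto simp: N_def i\<close>)
    have "\<exists>v. reach (S - {x}) a v \<and> SCE S v" if a: "a \<in> N" and b: "b \<in> N" and sep: "\<not> reach (S - {x}) a b" for a b
    proof -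
      define T where "T = insert x {y. reach (S - {x}) a y}"
      have a': "a \<in> S" "adj x a" "a \<noteq> x" and b': "b \<in> S" "b \<noteq> x"
        using a b by (auto simp: N_def)
      have T: "simply_connected T"
        unfolding T_def using component_with_center(1) less.prems(1) x(1) a' by blast
      have "T \<subseteq> S"
        using a' x(1) reach_closed[of "S - {x}" a] by (auto simp: T_def)
      moreover have "b \<notin> T" using sep b' by (simp add: T_def)
      ultimately have "card T < card S"
        using S(1) b' by (intro psubset_card_mono) auto
      moreover have "{x, a} \<subseteq> T" "finite T"
        using T by (auto simp: T_def simply_connected_def)
      then have "card {x, a} \<le> card T"
        by (intro card_mono)
      then have "2 \<le> card T" using a' by simp
      ultimately obtain u v where "u \<noteq> v" "SCE T u" "SCE T v"
        using less.hyps T by blast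
      \<comment> \<open>This is why the induction carries two points: one of them may be the cut
        point \<open>x\<close>, which is not SCE in \<open>S\<close>.\<close>
      then obtain w where w: "SCE T w" "w \<noteq> x" by metis
      then have "reach (S - {x}) a w"
        by (auto simp: T_def SCE_def erodable_def redundant_def)
      moreover from this have "SCE S w"
        using component_with_center(2)[OF less.prems(1) x(1) a'(1,2), of w] w by (simp add: T_def)
      ultimately show ?thesis by blast
    qed
    from this[OF ab(1,2) sep] this[OF ab(2,1)] sep
    obtain u v where "reach (S - {x}) a u" "SCE S u" "reach (S - {x}) b v" "SCE S v"
      using reach_sym by blast
    moreover from this have "u \<noteq> v"
      using sep reach_sym reach_trans by metis
    ultimately show ?thesis by blast
  qed
qed

section \<open>Distance levels\<close>

text \<open>These local conditions force \<open>d\<close> to be the distance to \<open>l\<close>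
  within \<open>S\<close>. Keeping \<open>d\<close> abstract lets one function serve all stages of
  the erosion.\<close>

definition is_level :: "point set \<Rightarrow> point \<Rightarrow> (point \<Rightarrow> nat) \<Rightarrow> bool" where
  "is_level S l d \<longleftrightarrow> l \<in> S \<and> d l = 0 \<and> (\<forall>x\<in>S. x \<noteq> l \<longrightarrow> (\<exists>y\<in>S. adj x y \<and> d x = d y + 1)) \<and>
     (\<forall>x\<in>S. \<forall>y\<in>S. adj x y \<longrightarrow> d x \<le> d y + 1)"

text \<open>Two conditions that distances to a base point satisfy in bridged graphs; the second is
  the triangle condition of weakly modular graphs.\<close>

definition geodesic :: "point set \<Rightarrow> (point \<Rightarrow> nat) \<Rightarrow> bool" where
  "geodesic S d \<longleftrightarrow>
     (\<forall>x\<in>S. \<forall>y\<in>S. \<forall>z\<in>S. adj x y \<longrightarrow> adj x z \<longrightarrow> d x = d y + 1 \<longrightarrow> d x = d z + 1 \<longrightarrow> y = z \<or> adj y z) \<and>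
     (\<forall>x\<in>S. \<forall>y\<in>S. adj x y \<longrightarrow> d x = d y \<longrightarrow> (\<exists>m\<in>S. adj m x \<and> adj m y \<and> d x = d m + 1))"

lemma is_level_down: "is_level S l d \<Longrightarrow> x \<in> S \<Longrightarrow> x \<noteq> l \<Longrightarrow> \<exists>y\<in>S. adj x y \<and> d x = d y + 1"
  and is_level_le: "is_level S l d \<Longrightarrow> x \<in> S \<Longrightarrow> y \<in> S \<Longrightarrow> adj x y \<Longrightarrow> d x \<le> d y + 1"
  and is_level_center: "is_level S l d \<Longrightarrow> l \<in> S"
  unfolding is_level_def by blast+

lemma geodesic_down: "geodesic S d \<Longrightarrow> x \<in> S \<Longrightarrow> y \<in> S \<Longrightarrow> z \<in> S \<Longrightarrow> adj x y \<Longrightarrow> adj x z \<Longrightarrow>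
    d x = d y + 1 \<Longrightarrow> d x = d z + 1 \<Longrightarrow> y = z \<or> adj y z"
  and geodesic_side: "geodesic S d \<Longrightarrow> x \<in> S \<Longrightarrow> y \<in> S \<Longrightarrow> adj x y \<Longrightarrow> d x = d y \<Longrightarrow>
    \<exists>m\<in>S. adj m x \<and> adj m y \<and> d x = d m + 1"
  unfolding geodesic_def by blast+

text \<open>Suppose \<open>x\<close> descends through \<open>v\<close> and \<open>v\<close> descends
  to \<open>z\<close>. Then \<open>x\<close> and \<open>z\<close> are two levels apart, hence not
  adjacent, so they are the ends of the arc of neighbours of \<open>v\<close>. The middle of the arc
  is present and replaces \<open>v\<close> as a lower neighbour of \<open>x\<close>.\<close>

lemma is_level_remove:
  assumes S: "hole_points S = {}" "is_level S l d" and v: "SCE S v" "v \<noteq> l"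
  shows "is_level (S - {v}) l d"
proof -
  obtain i where vS: "v \<in> S" and gap: "around v i True 3 \<notin> S" "around v i True 4 \<notin> S" "around v i True 5 \<notin> S"
    and arc: "around v i True 0 \<in> S \<Longrightarrow> around v i True 2 \<in> S \<Longrightarrow> around v i True 1 \<in> S"
    using SCE_aroundE[OF S(1) v(1)] by blast
  have nb: "u = around v i True 0 \<or> u = around v i True 1 \<or> u = around v i True 2" if "u \<in> S" "adj v u" for u
  proof -
    obtain k where "k < 6" "u = around v i True k" using \<open>adj v u\<close> by (meson adj_aroundE)
    then show ?thesis using that(1) gap unfolding less6_iff by metis
  qed
  have "\<exists>y\<in>S - {v}. adj x y \<and> d x = d y + 1" if x: "x \<in> S" "x \<noteq> v" "x \<noteq> l" for x
  proof -
    obtain y where y: "y \<in> S" "adj x y" "d x = d y + 1"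
      using is_level_down[OF S(2)] x by blast
    show ?thesis
    proof (cases "y = v")
      case False
      then show ?thesis using y by blast
    next
      case True
      obtain z where z: "z \<in> S" "adj v z" "d v = d z + 1"
        using is_level_down[OF S(2) vS v(2)] by blast
      have far: "\<not> adj x z" "x \<noteq> z"
        using is_level_le[OF S(2) x(1) z(1)] y z True by auto
      define m where "m = around v i True 1"
      have "{x, z} = {around v i True 0, around v i True 2}"
        using nb[OF x(1)] nb[OF z(1,2)] y(2) True adj_sym far
        by (auto simp: adj_around)
      then have "m \<in> S" "adj x m" "adj z m" "adj m z"
        using arc x(1) z(1) by (auto simp: doubleton_eq_iff m_def adj_around)
      moreover have "m \<noteq> v" by (simp add: m_def)
      moreover have "d x \<le> d m + 1" "d m \<le> d z + 1"
        using is_level_le[OF S(2)] calculation x(1) z(1) by blast+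
      ultimately show ?thesis
        using y(3) z(3) True by (intro bexI[of _ m]) auto
    qed
  qed
  then show ?thesis
    using S(2) v unfolding is_level_def by blast
qed

text \<open>The new point is nobody's lower neighbour: each of its neighbours equals or touches its
  lower neighbour \<open>e\<close>, hence is at level at most \<open>d v\<close>. Only pairs that
  contain \<open>v\<close> itself need a new argument, and there \<open>e\<close> serves.\<close>

lemma geodesic_insert_clique:
  assumes lev: "is_level (insert v T) l d" "v \<noteq> l" and T: "geodesic T d"
    and clique: "\<And>y z. y \<in> T \<Longrightarrow> z \<in> T \<Longrightarrow> adj v y \<Longrightarrow> adj v z \<Longrightarrow> y = z \<or> adj y z"
  shows "geodesic (insert v T) d"
proof -
  obtain e where e: "e \<in> T" "adj v e" "d v = d e + 1"
    using is_level_down[OF lev(1) _ lev(2)] adj_irrefl by blast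
  have no_up: "\<not> d x = d v + 1" if "x \<in> T" "adj x v" for x
    using clique[of x e] that e is_level_le[OF lev(1), of x e] adj_sym by fastforce
  have no_up': "adj x v \<Longrightarrow> x \<in> T \<Longrightarrow> d x = d v + 1 \<Longrightarrow> False" for x
    using no_up by blast
  show ?thesis
    unfolding geodesic_def
  proof (intro conjI ballI impI)
    fix x y z
    assume *: "x \<in> insert v T" "y \<in> insert v T" "z \<in> insert v T" "adj x y" "adj x z" "d x = d y + 1" "d x = d z + 1"
    show "y = z \<or> adj y z"
    proof (cases "x = v")
      case True
      then have "y \<in> T" "z \<in> T" using * adj_irrefl by blast+
      then show ?thesis using clique * True by blast
    next
      case False
      then have "y \<noteq> v" "z \<noteq> v" using no_up' * by blast+
      then show ?thesis using geodesic_down[OF T] * False by blast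
    qed
  next
    fix x y
    assume *: "x \<in> insert v T" "y \<in> insert v T" "adj x y" "d x = d y"
    have side: "\<exists>m\<in>insert v T. adj m v \<and> adj m z \<and> d v = d m + 1" if "z \<in> T" "adj v z" "d v = d z" for z
      using clique[of e z] e that adj_sym[of e z] adj_sym[of v e] by (intro bexI[of _ e]) auto
    show "\<exists>m\<in>insert v T. adj m x \<and> adj m y \<and> d x = d m + 1"
    proof (cases "x = v \<or> y = v")
      case True
      then show ?thesis
      proof
        assume "x = v"
        then show ?thesis using side[of y] * adj_irrefl by blast
      next
        assume "y = v"
        then show ?thesis using side[of x] * adj_irrefl adj_sym by fastforce
      qed
    next
      case False
      then show ?thesis using geodesic_side[OF T, of x y] * by blast
    qed
  qed
qed

text \<open>Otherwise either end of the arc yields a lower neighbour of \<open>m\<close>: the end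
  itself, or a common lower neighbour, which cannot be the missing position 4. One lies at 3 or 2,
  the other at 5 or 0, so they are distinct and not adjacent.\<close>

lemma arc_middle_lower:
  assumes T: "geodesic T d" and in_T: "m \<in> T" "around m i r 3 \<in> T" "around m i r 5 \<in> T" and out: "around m i r 4 \<notin> T"
    and le: "d (around m i r 3) \<le> d m + 1" "d m \<le> d (around m i r 3) + 1"
      "d (around m i r 5) \<le> d m + 1" "d m \<le> d (around m i r 5) + 1"
  shows "d (around m i r 3) = d m + 1 \<or> d (around m i r 5) = d m + 1"
proof (rule ccontr)
  assume neg: "\<not> ?thesis"
  define R where "R = around m i r"
  note RR = adj_around[of _ _ m i r, folded R_def] around_inj[of _ _ m i r, folded R_def]
  have adj_R: "adj m (R k)" "adj (R k) m" for k
    by (simp_all add: R_def)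
  note in_R = in_T(2,3)[folded R_def] out[folded R_def]
  have nb: "\<exists>k<6. u = R k" if "adj u m" for u
    using that adj_aroundE[of m u i r] adj_sym unfolding R_def by blast
  have "\<exists>k\<in>{3, 2}. R k \<in> T \<and> d m = d (R k) + 1"
  proof (cases "d (R 3) = d m")
    case True
    then obtain c where c: "c \<in> T" "adj c m" "adj c (R 3)" "d m = d c + 1"
      using geodesic_side[OF T in_T(1) in_R(1)] adj_R by metis
    then obtain k where "k < 6" "c = R k" using nb by blast
    then have "k = 2" using c in_R(3) unfolding less6_iff by (elim disjE) (simp_all add: RR)
    then show ?thesis using c \<open>c = R k\<close> by blast
  next
    case False
    then show ?thesis using neg le in_R unfolding R_def by (intro bexI[of _ 3]) auto
  qed
  moreover have "\<exists>k\<in>{5, 0}. R k \<in> T \<and> d m = d (R k) + 1"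
  proof (cases "d (R 5) = d m")
    case True
    then obtain c where c: "c \<in> T" "adj c m" "adj c (R 5)" "d m = d c + 1"
      using geodesic_side[OF T in_T(1) in_R(2)] adj_R by metis
    then obtain k where "k < 6" "c = R k" using nb by blast
    then have "k = 0" using c in_R(3) unfolding less6_iff by (elim disjE) (simp_all add: RR)
    then show ?thesis using c \<open>c = R k\<close> by blast
  next
    case False
    then show ?thesis using neg le in_R unfolding R_def by (intro bexI[of _ 5]) auto
  qed
  ultimately obtain j k where jk: "j \<in> {3, 2}" "k \<in> {5, 0}" "R j \<in> T" "R k \<in> T" "d m = d (R j) + 1" "d m = d (R k) + 1"
    by blast
  then have "R j = R k \<or> adj (R j) (R k)"
    using geodesic_down[OF T in_T(1)] adj_R by blast
  then show False
    using jk(1,2) by (auto simp: RR)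
qed

text \<open>The arc is indexed from its middle \<open>m\<close>, with the new point \<open>v\<close>
  at 4 and the ends \<open>b\<close>, \<open>a\<close> at 3 and 5. Since \<open>b\<close> is above
  \<open>m\<close>, only \<open>m\<close> and \<open>a\<close> can be below \<open>v\<close>, and
  they are adjacent. The delicate case is \<open>v\<close> as a second lower neighbour of
  \<open>b\<close>.\<close>

lemma geodesic_insert_arc:
  assumes lev: "is_level (insert (around m i r 4) T) l d" "around m i r 4 \<noteq> l" and T: "geodesic T d"
    and in_T: "m \<in> T" "around m i r 3 \<in> T" "around m i r 5 \<in> T" and out: "around m i r 4 \<notin> T"
    and nb: "\<And>u. u \<in> T \<Longrightarrow> adj (around m i r 4) u \<Longrightarrow> u = m \<or> u = around m i r 3 \<or> u = around m i r 5"
    and up: "d (around m i r 3) = d m + 1"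
  shows "geodesic (insert (around m i r 4) T) d"
proof -
  define R where "R = around m i r"
  note RR = adj_around[of _ _ m i r, folded R_def] around_inj[of _ _ m i r, folded R_def]
  define v a b where "v = R 4" and "a = R 5" and "b = R 3"
  have adj_R: "adj m (R k)" "adj (R k) m" for k
    by (simp_all add: R_def)
  have adjs: "adj v a" "adj a v" "adj v b" "adj b v" "adj v m" "adj m v" "adj a m" "adj m a" "adj b m" "adj m b"
    "\<not> adj a b" "a \<noteq> b" "v \<noteq> a" "v \<noteq> b"
    unfolding v_def a_def b_def using adj_R by (simp_all add: RR)
  have ins: "m \<in> T" "a \<in> T" "b \<in> T" "v \<notin> T"
    using in_T out by (simp_all add: a_def b_def v_def R_def)
  have lev': "is_level (insert v T) l d" "v \<noteq> l"
    using lev by (simp_all add: v_def R_def)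
  have nbv: "u = m \<or> u = b \<or> u = a" if "u \<in> T" "adj v u" for u
    using nb that by (simp add: a_def b_def v_def R_def)
  have le: "d x \<le> d y + 1" if "x \<in> insert v T" "y \<in> insert v T" "adj x y" for x y
    using is_level_le[OF lev'(1)] that by blast
  have ub: "d b = d m + 1" using up by (simp add: b_def R_def)
  have les: "d v \<le> d m + 1" "d m \<le> d v + 1" "d v \<le> d a + 1" "d a \<le> d v + 1" "d v \<le> d b + 1" "d b \<le> d v + 1"
    "d a \<le> d m + 1" "d m \<le> d a + 1"
    using le adjs ins by blast+
  obtain e where e: "e \<in> T" "adj v e" "d v = d e + 1"
    using is_level_down[OF lev'(1) _ lev'(2)] adj_irrefl by blast
  have low: "u = m \<or> u = a" if "u \<in> T" "adj v u" "d v = d u + 1" for u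
  proof -
    have "u \<noteq> b" using ub les(1) that(3) by auto
    then show ?thesis using nbv that by blast
  qed
  note e_cases = low[OF e]
  \<comment> \<open>Here \<open>x\<close> must be \<open>b\<close>, and \<open>m\<close> and
    \<open>v\<close> have equal level with \<open>a\<close> below both. A lower neighbour
    \<open>z\<close> of \<open>b\<close> other than \<open>m\<close> would sit at position 2; its
    common lower neighbour with \<open>m\<close> would be at position 1, not adjacent to
    \<open>a\<close> although both are below \<open>m\<close>.\<close>
  have common: "adj v z"
    if x: "x \<in> T" "adj x v" "d x = d v + 1" and z: "z \<in> T" "adj x z" "d x = d z + 1" for x z
  proof -
    have "x = b" "e = a" "d m = d v"
      using nbv[of x] x adj_sym e_cases e(3) ub les by auto
    have "z = m \<or> adj z m"
      using geodesic_down[OF T x(1) z(1) ins(1)] z \<open>x = b\<close> adjs ub by simp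
    moreover have False if zm: "adj z m"
    proof -
      obtain k where k: "k < 6" "z = R k"
        using zm adj_aroundE[of m z i r] adj_sym unfolding R_def by blast
      then have "k = 2"
        using z(1,2) \<open>x = b\<close> ins(4) unfolding less6_iff v_def b_def by (elim disjE) (simp_all add: RR)
      have "d z = d m" using z(3) x(3) \<open>d m = d v\<close> by simp
      then obtain c where c: "c \<in> T" "adj c z" "adj c m" "d z = d c + 1"
        using geodesic_side[OF T z(1) ins(1) zm] by blast
      obtain j where j: "j < 6" "c = R j"
        using c(3) adj_aroundE[of m c i r] adj_sym unfolding R_def by blast
      have "j = 1"
        using j(1) c(2,4) ub \<open>d z = d m\<close> unfolding less6_iff j(2) k(2) \<open>k = 2\<close> b_def
        by (elim disjE) (simp_all add: RR)
      have "R 1 = a \<or> adj (R 1) a"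
        using geodesic_down[OF T ins(1) c(1) ins(2)] c j(2) \<open>j = 1\<close> adj_R adjs e(3) \<open>e = a\<close> \<open>d m = d v\<close> \<open>d z = d m\<close>
        by simp
      then show False by (simp add: a_def RR)
    qed
    ultimately show ?thesis using adjs by blast
  qed
  have "geodesic (insert v T) d"
    unfolding geodesic_def
  proof (intro conjI ballI impI)
    fix x y z
    assume *: "x \<in> insert v T" "y \<in> insert v T" "z \<in> insert v T" "adj x y" "adj x z" "d x = d y + 1" "d x = d z + 1"
    show "y = z \<or> adj y z"
    proof (cases "x = v")
      case True
      then have "y \<in> T" "z \<in> T" using * adj_irrefl by blast+
      then have "y = m \<or> y = a" "z = m \<or> z = a"
        using low * True by blast+
      then show ?thesis using adjs by blast
    next
      case False
      then have x: "x \<in> T" using * by blast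
      consider "y = z" | "y = v" "z \<in> T" | "z = v" "y \<in> T" | "y \<in> T" "z \<in> T"
        using * by blast
      then show ?thesis
      proof cases
        case 2
        then show ?thesis using common[OF x, of z] * by blast
      next
        case 3
        then have "adj v y" using common[OF x, of y] * by blast
        then show ?thesis using 3 adj_sym by blast
      next
        case 4
        then show ?thesis using geodesic_down[OF T x] * by blast
      qed blast
    qed
  next
    fix x y
    assume *: "x \<in> insert v T" "y \<in> insert v T" "adj x y" "d x = d y"
    have side: "\<exists>c\<in>insert v T. adj c v \<and> adj c z \<and> d v = d c + 1" if z: "z \<in> T" "adj v z" "d v = d z" for z
    proof -
      have "z = m \<or> z = b \<or> z = a" using nbv z by blast
      then show ?thesis
      proof (elim disjE)
        assume "z = m"
        then show ?thesis using e e_cases z adjs ins by (intro bexI[of _ a]) auto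
      next
        assume "z = b"
        then show ?thesis using ub z adjs ins by (intro bexI[of _ m]) auto
      next
        assume "z = a"
        then show ?thesis using e e_cases z adjs ins by (intro bexI[of _ m]) auto
      qed
    qed
    show "\<exists>c\<in>insert v T. adj c x \<and> adj c y \<and> d x = d c + 1"
    proof (cases "x = v \<or> y = v")
      case True
      then show ?thesis
      proof
        assume "x = v"
        then show ?thesis using side[of y] * adj_irrefl by blast
      next
        assume y: "y = v"
        then have "x \<in> T" "adj v x" "d v = d x" using * adj_irrefl adj_sym by auto
        then show ?thesis using side[of x] y by metis
      qed
    next
      case False
      then show ?thesis using geodesic_side[OF T, of x y] * by blast
    qed
  qed
  then show ?thesis by (simp add: v_def R_def)
qed

text \<open>The induction puts one SCE point \<open>v\<close> back. Two SCE points are available, so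
  \<open>v\<close> can be chosen different from the centre, and the levels survive its
  removal.\<close>

lemma geodesic_if_simply_connected:
  assumes "simply_connected S" "is_level S l d"
  shows "geodesic S d"
  using assms
proof (induction "card S" arbitrary: S rule: less_induct)
  case less
  have S: "finite S" "hole_points S = {}"
    using less.prems by (auto simp: simply_connected_def)
  have l: "l \<in> S" using is_level_center[OF less.prems(2)] .
  show ?case
  proof (cases "S = {l}")
    case True
    then show ?thesis by (simp add: geodesic_def)
  next
    case False
    then obtain y where "y \<in> S" "y \<noteq> l" using l by blast
    then have "card {l, y} \<le> card S"
      using l S by (intro card_mono) auto
    then have "2 \<le> card S" using \<open>y \<noteq> l\<close> by simp
    then obtain v where v: "SCE S v" "v \<noteq> l"
      using two_SCE[OF less.prems(1)] by metis
    define T where "T = S - {v}"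
    have vS: "v \<in> S" using v by (simp add: SCE_def erodable_def redundant_def)
    then have ST: "S = insert v T" "v \<notin> T" by (auto simp: T_def)
    have "card T < card S"
      using S vS unfolding T_def by (intro psubset_card_mono) auto
    then have T: "geodesic T d"
      using less.hyps simply_connected_remove[OF less.prems(1) v(1)] is_level_remove[OF S(2) less.prems(2) v]
      unfolding T_def by blast
    obtain i where gap: "around v i True 3 \<notin> S" "around v i True 4 \<notin> S" "around v i True 5 \<notin> S"
      and arc: "around v i True 0 \<in> S \<Longrightarrow> around v i True 2 \<in> S \<Longrightarrow> around v i True 1 \<in> S"
      using SCE_aroundE[OF S(2) v(1)] by blast
    have nb: "u = around v i True 0 \<or> u = around v i True 1 \<or> u = around v i True 2" if "u \<in> S" "adj v u" for u
    proof -
      obtain k where "k < 6" "u = around v i True k" using \<open>adj v u\<close> by (meson adj_aroundE)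
      then show ?thesis using that(1) gap unfolding less6_iff by metis
    qed
    show ?thesis
    proof (cases "around v i True 0 \<in> S \<and> around v i True 2 \<in> S")
      case False
      have "y = z \<or> adj y z" if "y \<in> T" "z \<in> T" "adj v y" "adj v z" for y z
        using nb[of y] nb[of z] that False ST(1) by (auto simp: adj_around)
      then show ?thesis
        using geodesic_insert_clique[of v T l d] less.prems(2) v(2) T unfolding ST(1) by blast
    next
      case True
      define m where "m = around v i True 1"
      \<comment> \<open>The arc around \<open>v\<close> is re-read from its middle point.\<close>
      have ring: "around m i True 4 = v" "around m i True 5 = around v i True 0" "around m i True 3 = around v i True 2"
        unfolding m_def by (rule around_shift)+
      have in_S: "m \<in> S" "around m i True 3 \<in> S" "around m i True 5 \<in> S" "around m i True 4 \<in> S"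
        using True arc vS unfolding ring by (simp_all add: m_def)
      then have in_T: "m \<in> T" "around m i True 3 \<in> T" "around m i True 5 \<in> T"
        using ring by (auto simp: T_def m_def)
      have nb': "u = m \<or> u = around m i True 3 \<or> u = around m i True 5" if "u \<in> T" "adj (around m i True 4) u" for u
        using nb[of u] that ST(1) unfolding ring by (auto simp: m_def)
      have lev: "is_level (insert (around m i True 4) T) l d" "around m i True 4 \<noteq> l" "around m i True 4 \<notin> T"
        using less.prems(2) v(2) ST ring by simp_all
      have "d (around m i True 3) = d m + 1 \<or> d (around m i True 5) = d m + 1"
        using is_level_le[OF less.prems(2)] in_S by (intro arc_middle_lower[OF T in_T lev(3)]) auto
      then have "geodesic (insert (around m i True 4) T) d"
      proof
        assume "d (around m i True 3) = d m + 1"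
        then show ?thesis
          using geodesic_insert_arc[OF lev(1,2) T in_T lev(3) nb'] by blast
      next
        \<comment> \<open>The mirror image of the previous case, obtained by reversing the
          orientation.\<close>
        assume up: "d (around m i True 5) = d m + 1"
        show ?thesis
          using geodesic_insert_arc[of m "i + 2" False T l d] lev T in_T nb' up
          unfolding around_flip by blast
      qed
      then show ?thesis using ST(1) ring by simp
    qed
  qed
qed

section \<open>Rows of a level\<close>

lemma around_rot:
  "around v (i + 5) True 0 = around v i True 5" "around v (i + 5) True 1 = around v i True 0"
  "around v (i + 5) True 2 = around v i True 1" "around v (i + 5) True 3 = around v i True 2"
  "around v (i + 5) True 4 = around v i True 3" "around v (i + 5) True 5 = around v i True 4"
proof -
  have eqs: "i + 5 + 0 = i + 5" "i + 5 + 1 = i + 6" "i + 5 + 2 = i + 7" "i + 5 + 3 = i + 8" "i + 5 + 4 = i + 9" "i + 5 + 5 = i + 10"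
    by simp_all
  show "around v (i + 5) True 0 = around v i True 5" "around v (i + 5) True 1 = around v i True 0"
    "around v (i + 5) True 2 = around v i True 1" "around v (i + 5) True 3 = around v i True 2"
    "around v (i + 5) True 4 = around v i True 3" "around v (i + 5) True 5 = around v i True 4"
    by (simp_all only: around_def if_True eqs nbr_add6 add_0_right)
qed

text \<open>The row runs in direction \<open>i\<close>, and its lower side is at the positions 1 and
  2; so \<open>i\<close> fixes both the line and the side on which the centre lies.\<close>

definition flat :: "point set \<Rightarrow> (point \<Rightarrow> nat) \<Rightarrow> point \<Rightarrow> nat \<Rightarrow> bool" where
  "flat S d x i \<longleftrightarrow> x \<in> S \<and> around x i True 0 \<in> S \<and> around x i True 1 \<in> S \<and>
     around x i True 2 \<in> S \<and> around x i True 3 \<in> S \<and>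
     d (around x i True 0) = d x \<and> d (around x i True 3) = d x \<and>
     d x = d (around x i True 1) + 1 \<and> d x = d (around x i True 2) + 1"

lemma flat_mono: "flat S d x i \<Longrightarrow> S \<subseteq> A \<Longrightarrow> flat A d x i"
  unfolding flat_def by blast

text \<open>No third lower neighbour can be adjacent to both of the given ones. A neighbour of equal
  level shares a lower one with \<open>x\<close>, hence sits at 2 or 5, and not both occur, as this
  would be flat. So a gap of three remains, and the present neighbours do not break the arc.\<close>

lemma SCE_if_top_two_down:
  assumes S: "hole_points S = {}" "geodesic S d" and x: "x \<in> S"
    and top: "\<And>u. u \<in> S \<Longrightarrow> adj x u \<Longrightarrow> d u = d x \<or> d x = d u + 1"
    and not_flat: "\<And>i. \<not> flat S d x i"
    and down: "around x i True 0 \<in> S" "d x = d (around x i True 0) + 1"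
      "around x i True 1 \<in> S" "d x = d (around x i True 1) + 1"
  shows "SCE S x"
proof -
  define A where "A = around x i True"
  note AA = adj_around[of _ _ x i True, folded A_def] around_inj[of _ _ x i True, folded A_def]
  have adj_A: "adj x (A k)" for k by (simp add: A_def)
  note downA = down[folded A_def]
  have lower: "k = 0 \<or> k = 1" if k: "k < 6" "A k \<in> S" "d x = d (A k) + 1" for k
  proof -
    have "A k = A 0 \<or> adj (A k) (A 0)" "A k = A 1 \<or> adj (A k) (A 1)"
      using geodesic_down[OF S(2) x k(2) _ adj_A adj_A k(3)] downA by blast+
    then show ?thesis
      using k(1) unfolding less6_iff by (elim disjE) (simp_all add: AA)
  qed
  have sides: "k = 0 \<or> k = 1 \<or> k = 2 \<or> k = 5" if k: "k < 6" "A k \<in> S" for k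
  proof (cases "d x = d (A k) + 1")
    case True
    then show ?thesis using lower k by blast
  next
    case False
    then have "d x = d (A k)" using top[OF k(2) adj_A] by metis
    then obtain m where m: "m \<in> S" "adj m x" "adj m (A k)" "d x = d m + 1"
      using geodesic_side[OF S(2) x k(2) adj_A] by blast
    obtain j where j: "j < 6" "m = A j"
      using m(2) adj_aroundE[of x m i True] adj_sym unfolding A_def by blast
    then have "j = 0 \<or> j = 1" using lower m by blast
    then show ?thesis
      using m(3) k(1) unfolding j(2) less6_iff by (elim disjE) (simp_all add: AA)
  qed
  have out: "A 3 \<notin> S" "A 4 \<notin> S"
    using sides[of 3] sides[of 4] by auto
  have not52: "\<not> (A 5 \<in> S \<and> A 2 \<in> S)"
  proof
    assume *: "A 5 \<in> S \<and> A 2 \<in> S"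
    then have "d (A 5) = d x" "d (A 2) = d x"
      using lower[of 5] lower[of 2] top[OF _ adj_A, of 5] top[OF _ adj_A, of 2] by auto
    then have "flat S d x (i + 5)"
      unfolding flat_def around_rot A_def[symmetric] using * x downA by simp
    then show False using not_flat by blast
  qed
  show ?thesis
  proof (cases "A 2 \<in> S")
    case True
    then have "A 5 \<notin> S" using not52 by blast
    then show ?thesis
      using out downA(3) SCE_around[OF S(1) x, of i True] unfolding A_def by blast
  next
    case False
    then show ?thesis
      using out downA(1) SCE_around[OF S(1) x, of "i + 5" True] unfolding A_def around_rot by blast
  qed
qed

text \<open>If the lower neighbour is unique, every other neighbour has equal level and touches it;
  the arc then has that lower neighbour as its middle.\<close>

lemma SCE_if_top:
  assumes S: "hole_points S = {}" "geodesic S d" "is_level S l d" and x: "x \<in> S" "x \<noteq> l"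
    and no_up: "\<And>u. u \<in> S \<Longrightarrow> adj x u \<Longrightarrow> d u \<noteq> d x + 1"
    and not_flat: "\<And>i. \<not> flat S d x i"
  shows "SCE S x"
proof -
  have top: "d u = d x \<or> d x = d u + 1" if "u \<in> S" "adj x u" for u
    using no_up[OF that] is_level_le[OF S(3) x(1) that] is_level_le[OF S(3) that(1) x(1) adj_sym[OF that(2)]]
    by linarith
  obtain y where y: "y \<in> S" "adj x y" "d x = d y + 1"
    using is_level_down[OF S(3) x] by blast
  obtain i where i: "y = around x i True 0"
    using y(2) by (auto simp: around_def adj_iff)
  define A where "A = around x i True"
  note AA = adj_around[of _ _ x i True, folded A_def] around_inj[of _ _ x i True, folded A_def]
  have adj_A: "adj x (A k)" for k by (simp add: A_def)
  have A0: "A 0 \<in> S" "d x = d (A 0) + 1" using y i by (simp_all add: A_def)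
  show ?thesis
  proof (cases "A 1 \<in> S \<and> d x = d (A 1) + 1")
    case True
    then show ?thesis
      using SCE_if_top_two_down[OF S(1,2) x(1) top not_flat, of i] A0 unfolding A_def by blast
  next
    case no1: False
    show ?thesis
    proof (cases "A 5 \<in> S \<and> d x = d (A 5) + 1")
      case True
      then show ?thesis
        using SCE_if_top_two_down[OF S(1,2) x(1) top not_flat, of "i + 5"] A0 unfolding A_def around_rot by blast
    next
      case no5: False
      have lower: "k = 0" if k: "k < 6" "A k \<in> S" "d x = d (A k) + 1" for k
      proof -
        have "A k = A 0 \<or> adj (A k) (A 0)"
          using geodesic_down[OF S(2) x(1) k(2) _ adj_A adj_A k(3)] A0 by blast
        then show ?thesis
          using k no1 no5 unfolding less6_iff by (elim disjE) (simp_all add: AA)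
      qed
      have sides: "k = 0 \<or> k = 1 \<or> k = 5" if k: "k < 6" "A k \<in> S" for k
      proof (cases "d x = d (A k) + 1")
        case True
        then show ?thesis using lower k by blast
      next
        case False
        then have "d x = d (A k)" using top[OF k(2) adj_A] by metis
        then obtain m where m: "m \<in> S" "adj m x" "adj m (A k)" "d x = d m + 1"
          using geodesic_side[OF S(2) x(1) k(2) adj_A] by blast
        obtain j where j: "j < 6" "m = A j"
          using m(2) adj_aroundE[of x m i True] adj_sym unfolding A_def by blast
        then have "j = 0" using lower m by blast
        then show ?thesis
          using m(3) k(1) unfolding j(2) less6_iff by (elim disjE) (simp_all add: AA)
      qed
      have "A 2 \<notin> S" "A 3 \<notin> S" "A 4 \<notin> S"
        using sides[of 2] sides[of 3] sides[of 4] by auto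
      then show ?thesis
        using A0 SCE_around[OF S(1) x(1), of "i + 5" True] unfolding A_def around_rot by blast
    qed
  qed
qed

text \<open>A flat point can only be eroded after one of its two neighbours at the same level.
  \<open>near A d x k\<close> says that on the straight row of flat points through \<open>x\<close> an end is at most
  \<open>k\<close> steps away, so that \<open>x\<close> waits for at most \<open>k\<close> erosions in its own row.\<close>

definition near :: "point set \<Rightarrow> (point \<Rightarrow> nat) \<Rightarrow> point \<Rightarrow> nat \<Rightarrow> bool" where
  "near A d x k \<longleftrightarrow> (\<forall>i. flat A d x i \<longrightarrow>
     (\<exists>j\<le>k. \<not> flat A d (ray x i j) i \<or> \<not> flat A d (ray x (i + 3) j) i))"

lemma near_0: "near A d x 0 \<Longrightarrow> \<not> flat A d x i"
  by (auto simp: near_def)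

lemma ray_nbr: "ray (nbr q i) i n = ray q i (Suc n)"
  by (simp add: ray_def nbr_def algebra_simps)

lemma nbr_cong: "i mod 6 = i' mod 6 \<Longrightarrow> nbr v (i + k) = nbr v (i' + k)"
  by (metis mod_add_left_eq nbr_mod)

lemma around_cong: "i mod 6 = i' mod 6 \<Longrightarrow> around v i True k = around v i' True k"
  unfolding around_def if_True by (rule nbr_cong)

lemma flat_cong:
  assumes "i mod 6 = i' mod 6"
  shows "flat A d x i \<longleftrightarrow> flat A d x i'"
  unfolding flat_def around_cong[OF assms] ..

lemma ray_cong: "i mod 6 = i' mod 6 \<Longrightarrow> ray q (i + k) n = ray q (i' + k) n"
  unfolding ray_def by (metis dir_mod mod_add_left_eq)

lemma rel_direction: "\<exists>k<6. i' mod 6 = (i + k) mod (6::nat)"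
proof (intro exI conjI)
  \<comment> \<open>\<open>5 * i\<close> stands for \<open>- i\<close> modulo 6.\<close>
  show "(i' + 5 * i) mod 6 < 6" by simp
  have "(i + (i' + 5 * i) mod 6) mod 6 = (i + (i' + 5 * i)) mod 6"
    by (rule mod_add_right_eq)
  also have "i + (i' + 5 * i) = i' + 6 * i" by simp
  also have "(i' + 6 * i) mod 6 = i' mod 6" by (rule mod_mult_self2)
  finally show "i' mod 6 = (i + (i' + 5 * i) mod 6) mod 6" by (rule sym)
qed

text \<open>\<open>near\<close> quantifies over all directions. This pins the direction at a row
  neighbour to that of the row: the lower pair must contain or touch position \<open>m\<close>, and
  the equal level on one side leaves only one such pair.\<close>

lemma flat_direction_unique:
  assumes "geodesic A d" "flat A d y i'" "around y i True m \<in> A" "m = 1 \<or> m = 2"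
    and "d y = d (around y i True m) + 1" "d (around y i True (if m = 2 then 3 else 0)) = d y"
  shows "i' mod 6 = i mod 6"
proof -
  obtain k where k: "k < 6" "i' mod 6 = (i + k) mod 6"
    using rel_direction by blast
  have fl: "flat A d y (i + k)"
    using assms(2) flat_cong[OF k(2)] by blast
  define R where "R = around y i True"
  note RR = adj_around[of _ _ y i True, folded R_def] around_inj[of _ _ y i True, folded R_def]
  have adj_R: "adj y (R j)" for j by (simp add: R_def)
  have eq: "around y (i + k) True j = R ((k + j) mod 6)" for j
  proof -
    have "nbr y (i + (k + j)) = nbr y (i + (k + j) mod 6)"
      by (metis mod_add_right_eq nbr_mod)
    then show ?thesis by (simp add: R_def around_def add.assoc)
  qed
  have y: "y \<in> A" using fl by (simp add: flat_def)
  have flk: "R ((k + 1) mod 6) \<in> A" "R ((k + 2) mod 6) \<in> A"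
    "d (R ((k + 0) mod 6)) = d y" "d (R ((k + 3) mod 6)) = d y"
    "d y = d (R ((k + 1) mod 6)) + 1" "d y = d (R ((k + 2) mod 6)) + 1"
    using fl unfolding flat_def eq by blast+
  have m: "R m \<in> A" "d y = d (R m) + 1" "d (R (if m = 2 then 3 else 0)) = d y"
    using assms(3-6) by (simp_all add: R_def)
  have "R m = R ((k + 1) mod 6) \<or> adj (R m) (R ((k + 1) mod 6))"
    "R m = R ((k + 2) mod 6) \<or> adj (R m) (R ((k + 2) mod 6))"
    using geodesic_down[OF assms(1) y m(1) _ adj_R adj_R m(2)] flk by blast+
  then have "k = 0"
    using assms(4) k(1) flk m unfolding less6_iff by (elim disjE) (simp_all add: RR)
  then show ?thesis using k(2) by simp
qed

text \<open>The row neighbour towards the nearer end is one step closer to it. If that neighbour is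
  not flat, \<open>near\<close> holds for it vacuously.\<close>

lemma near_side:
  assumes g: "geodesic A d" and x: "flat A d x i" and near: "near A d x (Suc k)"
  shows "near A d (around x i True 0) k \<or> near A d (around x i True 3) k"
proof -
  have fx: "around x i True 1 \<in> A" "around x i True 2 \<in> A"
    "d (around x i True 0) = d x" "d (around x i True 3) = d x"
    "d x = d (around x i True 1) + 1" "d x = d (around x i True 2) + 1"
    using x unfolding flat_def by blast+
  obtain j where j: "j \<le> Suc k" "\<not> flat A d (ray x i j) i \<or> \<not> flat A d (ray x (i + 3) j) i"
    using near x unfolding near_def by blast
  have "j \<noteq> 0" using j(2) x by (metis ray_0)
  then obtain j' where j': "j = Suc j'" "j' \<le> k" using j(1) by (cases j) auto
  from j(2) show ?thesis
  proof
    assume nf: "\<not> flat A d (ray x i j) i"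
    define y where "y = around x i True 0"
    have y: "y = nbr x i" by (simp add: y_def around_def)
    have r: "around y i True 2 = around x i True 1" "around y i True 3 = x"
      unfolding y_def by (rule around_shift)+
    have "near A d y k"
      unfolding near_def
    proof (intro allI impI)
      fix i' assume fl: "flat A d y i'"
      have i': "i' mod 6 = i mod 6"
        by (rule flat_direction_unique[OF g fl, of i 2]) (use fx in \<open>simp_all add: r y_def[symmetric]\<close>)
      have "ray y (i' + 0) j' = ray y (i + 0) j'" by (rule ray_cong[OF i'])
      then have "ray y i' j' = ray x i j" by (simp add: y j' ray_nbr)
      then show "\<exists>j\<le>k. \<not> flat A d (ray y i' j) i' \<or> \<not> flat A d (ray y (i' + 3) j) i'"
        using nf j' flat_cong[OF i'] by metis
    qed
    then show ?thesis by (simp add: y_def)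
  next
    assume nf: "\<not> flat A d (ray x (i + 3) j) i"
    define y where "y = around x i True 3"
    have y: "y = nbr x (i + 3)" by (simp add: y_def around_def)
    have r: "around y i True 1 = around x i True 2" "around y i True 0 = x"
      unfolding y_def by (rule around_shift)+
    have "near A d y k"
      unfolding near_def
    proof (intro allI impI)
      fix i' assume fl: "flat A d y i'"
      have i': "i' mod 6 = i mod 6"
        by (rule flat_direction_unique[OF g fl, of i 1]) (use fx r in \<open>simp_all add: y_def[symmetric]\<close>)
      have "ray y (i' + 3) j' = ray y (i + 3) j'" by (rule ray_cong[OF i'])
      then have "ray y (i' + 3) j' = ray x (i + 3) j" by (simp add: y j' ray_nbr)
      then show "\<exists>j\<le>k. \<not> flat A d (ray y i' j) i' \<or> \<not> flat A d (ray y (i' + 3) j) i'"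
        using nf j' flat_cong[OF i'] by metis
    qed
    then show ?thesis by (simp add: y_def)
  qed
qed

text \<open>Three consecutive flat points determine four consecutive points of the row below, all at
  one level. Each edge of that row has a common lower neighbour, and it must lie on the far side
  because the near side is the higher row.\<close>

lemma flat_below:
  assumes g: "geodesic A d" and u: "flat A d u i" "flat A d (nbr u i) i" "flat A d (nbr u (i + 3)) i"
  shows "flat A d (around u i True 1) i" "flat A d (around u i True 2) i"
proof -
  define x x' r l where "x = around u i True 1" and "x' = around u i True 2"
    and "r = nbr u i" and "l = nbr u (i + 3)"
  have rl: "r = around u i True 0" "l = around u i True 3"
    by (simp_all add: r_def l_def around_def)
  define xr b c xl e where "xr = around r i True 1" and "b = around x i True 2" and "c = around x i True 1"
    and "xl = around l i True 2" and "e = around x' i True 2"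
  have x: "around x i True 0 = xr" "around x i True 3 = x'" "around x i True 4 = u" "around x i True 5 = r"
    unfolding x_def x'_def xr_def rl by (simp_all only: around_shift)
  have x': "around x' i True 0 = x" "around x' i True 1 = b" "around x' i True 3 = xl" "around x' i True 4 = l"
    "around x' i True 5 = u"
    unfolding x_def x'_def xl_def b_def rl by (simp_all only: around_shift)
  have "around r i True 2 = x" "around l i True 1 = x'"
    unfolding x_def x'_def rl by (simp_all only: around_shift)
  note fl = u[folded r_def l_def, unfolded flat_def, folded x_def x'_def rl xr_def xl_def, unfolded this]
  have lev: "x \<in> A" "x' \<in> A" "xr \<in> A" "xl \<in> A" "d x' = d x" "d xr = d x" "d xl = d x" "d u = d x + 1" "d l = d x + 1" "d r = d x + 1"
    using fl by simp_all
  \<comment> \<open>Adjacent points have two common neighbours, here at \<open>k'\<close> and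
    \<open>k''\<close>; excluding one by its level leaves the other.\<close>
  have third: "around z i True k' \<in> A \<and> d z = d (around z i True k') + 1"
    if z: "z \<in> A" "around z i True k \<in> A" "d z = d (around z i True k)" "k < 6" "k' < 6" "k'' < 6"
      "\<not> d z = d (around z i True k'') + 1"
      "\<And>j. j < 6 \<Longrightarrow> j = (k + 1) mod 6 \<or> k = (j + 1) mod 6 \<Longrightarrow> j = k' \<or> j = k''" for z k k' k''
  proof -
    obtain m where m: "m \<in> A" "adj m z" "adj m (around z i True k)" "d z = d m + 1"
      using geodesic_side[OF g z(1,2) adj_around_center(1) z(3)] by blast
    obtain j where j: "j < 6" "m = around z i True j"
      using m(2) adj_aroundE[of z m i True] adj_sym by blast
    then have "j = k' \<or> j = k''"
      using m(3) z(4,8) adj_around[of j k z i True] by auto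
    then show ?thesis using m j z(7) by auto
  qed
  have three: "j = 2 \<or> j = 4" if "j < 6" "j = (3 + 1) mod 6 \<or> 3 = (j + 1) mod 6" for j :: nat
    using that unfolding less6_iff by (elim disjE) simp_all
  have zero: "j = 1 \<or> j = 5" if "j < 6" "j = (0 + 1) mod 6 \<or> 0 = (j + 1) mod 6" for j :: nat
    using that unfolding less6_iff by (elim disjE) simp_all
  have b: "b \<in> A \<and> d x = d b + 1"
    unfolding b_def by (rule third[of x 3 2 4, OF _ _ _ _ _ _ _ three, unfolded x]) (use lev in simp_all)
  have c: "c \<in> A \<and> d x = d c + 1"
    unfolding c_def by (rule third[of x 0 1 5, OF _ _ _ _ _ _ _ zero, unfolded x]) (use lev in simp_all)
  have e: "e \<in> A \<and> d x = d e + 1"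
    using third[of x' 3 2 4, OF _ _ _ _ _ _ _ three, unfolded x' e_def[symmetric]] lev by simp
  show "flat A d (around u i True 1) i" "flat A d (around u i True 2) i"
    unfolding flat_def x_def[symmetric] x'_def[symmetric] x x' b_def[symmetric] c_def[symmetric] e_def[symmetric]
    using lev b c e by auto
qed

text \<open>If the row of \<open>u\<close> were flat for \<open>Suc k\<close> steps both ways,
  \<open>flat_below\<close> would make the row below flat for \<open>k\<close> steps both ways
  around \<open>x\<close>. One step is lost since \<open>flat_below\<close> needs both row
  neighbours.\<close>

lemma near_up:
  assumes g: "geodesic A d" and x: "x \<in> A" "u \<in> A" "adj u x" "d u = d x + 1" and near: "near A d x k"
  shows "near A d u (Suc k)"
  unfolding near_def
proof (intro allI impI, rule ccontr)
  fix i
  assume u: "flat A d u i" and "\<not> (\<exists>j\<le>Suc k. \<not> flat A d (ray u i j) i \<or> \<not> flat A d (ray u (i + 3) j) i)"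
  then have row: "flat A d (ray u i j) i" "flat A d (ray u (i + 3) j) i" if "j \<le> Suc k" for j
    using that by blast+
  define R where "R = around u i True"
  note RR = adj_around[of _ _ u i True, folded R_def] around_inj[of _ _ u i True, folded R_def]
  have adj_R: "adj u (R j)" for j by (simp add: R_def)
  have fu: "R 1 \<in> A" "R 2 \<in> A" "d u = d (R 1) + 1" "d u = d (R 2) + 1"
    using u unfolding flat_def R_def by blast+
  obtain m where m: "m < 6" "x = R m"
    using x(3) adj_aroundE[of u x i True] unfolding R_def by blast
  have "x = R 1 \<or> adj x (R 1)" "x = R 2 \<or> adj x (R 2)"
    using geodesic_down[OF g x(2,1) _ x(3) adj_R x(4)] fu by blast+
  then have m12: "m = 1 \<or> m = 2"
    using m(1) unfolding m(2) less6_iff by (elim disjE) (simp_all add: RR)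
  have step_back: "nbr (ray u i (Suc j)) (i + 3) = ray u i j" "nbr (ray u (i + 3) (Suc j)) i = ray u (i + 3) j" for j
    using dir_shift(3)[of i] by (simp_all add: ray_def nbr_def algebra_simps)
  have "flat A d (around (ray u i j) i True m) i" if "j \<le> k" for j
  proof -
    \<comment> \<open>For \<open>j = 0\<close> the preceding row point lies on the opposite
      ray.\<close>
    have "flat A d (nbr (ray u i j) (i + 3)) i"
    proof (cases j)
      case 0
      then show ?thesis using row(2)[of 1] by (simp add: ray_Suc)
    next
      case (Suc j')
      then show ?thesis using row(1)[of j'] that step_back(1) by simp
    qed
    moreover have "flat A d (nbr (ray u i j) i) i"
      using row(1)[of "Suc j"] that by (simp add: ray_Suc)
    ultimately show ?thesis
      using flat_below[OF g row(1)[of j]] that m12 by auto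
  qed
  moreover have "flat A d (around (ray u (i + 3) j) i True m) i" if "j \<le> k" for j
  proof -
    have "flat A d (nbr (ray u (i + 3) j) i) i"
    proof (cases j)
      case 0
      then show ?thesis using row(1)[of 1] by (simp add: ray_Suc)
    next
      case (Suc j')
      then show ?thesis using row(2)[of j'] that step_back(2) by simp
    qed
    moreover have "flat A d (nbr (ray u (i + 3) j) (i + 3)) i"
      using row(2)[of "Suc j"] that by (simp add: ray_Suc)
    ultimately show ?thesis
      using flat_below[OF g row(2)[of j]] that m12 by auto
  qed
  moreover have "around (ray u i0 j) i True m = ray x i0 j" for i0 j
    by (simp add: m(2) R_def around_def ray_def nbr_def)
  ultimately have "flat A d (ray x i j) i" "flat A d (ray x (i + 3) j) i" if "j \<le> k" for j
    using that by simp_all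
  then show False
    using near unfolding near_def by (metis ray_0 zero_le)
qed

lemma level_coordinate_bound:
  assumes "is_level A l d" "x \<in> A"
  shows "\<bar>fst x - fst l\<bar> \<le> int (d x) \<and> \<bar>snd x - snd l\<bar> \<le> int (d x)"
  using assms(2)
proof (induction "d x" arbitrary: x rule: less_induct)
  case less
  show ?case
  proof (cases "x = l")
    case False
    then obtain y where y: "y \<in> A" "adj x y" "d x = d y + 1"
      using is_level_down[OF assms(1) less.prems] by blast
    have "\<bar>fst x - fst y\<bar> \<le> 1" "\<bar>snd x - snd y\<bar> \<le> 1"
      using y(2) by (auto simp: adj_coord)
    then show ?thesis
      using less.hyps[OF _ y(1)] y(3) by (simp; linarith)
  qed simp
qed

text \<open>Otherwise the two points \<open>Suc (d x)\<close> steps away along the row are both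
  still at level \<open>d x\<close>, so each coordinate differs from that of \<open>l\<close> by at
  most \<open>d x\<close>. But some coordinate separates them by
  \<open>2 * Suc (d x)\<close>.\<close>

lemma near_level:
  assumes "is_level A l d"
  shows "near A d x (d x)"
  unfolding near_def
proof (intro allI impI, rule ccontr)
  fix i
  assume "flat A d x i" and "\<not> (\<exists>j\<le>d x. \<not> flat A d (ray x i j) i \<or> \<not> flat A d (ray x (i + 3) j) i)"
  then have row: "flat A d (ray x i j) i" "flat A d (ray x (i + 3) j) i" if "j \<le> d x" for j
    using that by blast+
  have right: "ray x i j \<in> A \<and> d (ray x i j) = d x" if "j \<le> Suc (d x)" for j
    using that
  proof (induction j)
    case 0
    then show ?case using row(1)[of 0] by (simp add: flat_def)
  next
    case (Suc j)
    have "ray x i (Suc j) = around (ray x i j) i True 0"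
      by (simp add: ray_Suc around_def)
    then show ?case
      using Suc row(1)[of j] unfolding flat_def by simp
  qed
  have left: "ray x (i + 3) j \<in> A \<and> d (ray x (i + 3) j) = d x" if "j \<le> Suc (d x)" for j
    using that
  proof (induction j)
    case 0
    then show ?case using row(2)[of 0] by (simp add: flat_def)
  next
    case (Suc j)
    have "ray x (i + 3) (Suc j) = around (ray x (i + 3) j) i True 3"
      by (simp add: ray_Suc around_def)
    then show ?case
      using Suc row(2)[of j] unfolding flat_def by simp
  qed
  define n where "n = Suc (d x)"
  define p q where "p = ray x i n" and "q = ray x (i + 3) n"
  have "\<bar>fst p - fst l\<bar> \<le> int (d x)" "\<bar>snd p - snd l\<bar> \<le> int (d x)"
    "\<bar>fst q - fst l\<bar> \<le> int (d x)" "\<bar>snd q - snd l\<bar> \<le> int (d x)"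
    using level_coordinate_bound[OF assms, of p] level_coordinate_bound[OF assms, of q] right[of n] left[of n]
    unfolding n_def p_def q_def by simp_all
  moreover have "fst p - fst q = 2 * int n * fst (dir i)" "snd p - snd q = 2 * int n * snd (dir i)"
    by (simp_all add: p_def q_def ray_def dir_shift(3))
  ultimately show False
    using dir_in[of i] by (auto simp: n_def)
qed

section \<open>An invariant of the configurations\<close>

lemma boundary_point_iff: "boundary_point S v \<longleftrightarrow> v \<in> S \<and> (\<exists>u. adj v u \<and> u \<notin> S)"
  unfolding boundary_point_def adj_def by blast

lemma port_pt_adj [simp]: "adj x (port_pt ori p x i)"
  by (simp add: port_pt_def)

lemma adj_port_ptE:
  assumes "adj x y"
  obtains i where "i < 6" "port_pt ori p x i = y"
proof -
  obtain k where k: "y = nbr x k" using assms by (auto simp: adj_iff)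
  obtain j where j: "j < 6" "k mod 6 = (ori p + j) mod 6"
    using rel_direction by blast
  then have "port_pt ori p x j = y"
    unfolding port_pt_def k by (metis add.commute nbr_mod)
  then show thesis using j(1) that by blast
qed

text \<open>The ends of the arc touch the gap and are boundary points, so only the middle can be
  interior. Thus an erosion exposes at most one point, which a single expanding particle can
  cover.\<close>

lemma SCE_interior_nbr_unique:
  assumes "hole_points S = {}" "SCE S v" and u: "u \<in> S" "adj v u" "\<not> boundary_point S u"
    and w: "w \<in> S" "adj v w" "\<not> boundary_point S w"
  shows "u = w"
proof -
  obtain i where gap: "around v i True 3 \<notin> S" "around v i True 4 \<notin> S" "around v i True 5 \<notin> S"
    using SCE_aroundE[OF assms(1,2)] by blast
  have "adj (around v i True 0) (around v i True 5)" "adj (around v i True 2) (around v i True 3)"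
    by (simp_all add: adj_around)
  then have b: "boundary_point S z" if "z \<in> S" "z = around v i True 0 \<or> z = around v i True 2" for z
    using that gap unfolding boundary_point_iff by blast
  have "z = around v i True 1" if z: "z \<in> S" "adj v z" "\<not> boundary_point S z" for z
  proof -
    obtain k where "k < 6" "z = around v i True k" using z(2) by (meson adj_aroundE)
    then show ?thesis using z b gap unfolding less6_iff by metis
  qed
  then show ?thesis using u w by blast
qed

lemma connected_isolated:
  assumes "connected_shape S" "x \<in> S" "\<And>u. adj x u \<Longrightarrow> u \<notin> S"
  shows "S = {x}"
proof -
  have "y = x" if "y \<in> S" for y
  proof -
    have "reach S x y" using assms(1,2) that by (simp add: connected_shape_iff)
    then show ?thesis
      by (induction rule: reach_induct) (use assms(3) in auto)
  qed
  then show ?thesis using assms(2) by blast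
qed

text \<open>Progress rests on the clause that boundary points are heads. Tails of expanded particles
  lie outside \<open>Se c\<close>, so an occupied eligible point always carries a head; the
  exception \<open>Se c = {head c p}\<close> admits the leader.\<close>

definition invar :: "nat set \<Rightarrow> (nat \<Rightarrow> nat) \<Rightarrow> config \<Rightarrow> bool" where
  "invar P ori c \<longleftrightarrow> simply_connected (Se c) \<and> Se c \<noteq> {} \<and> inj_on (head c) P \<and>
     (\<forall>p\<in>P. status c p = Undecided \<longrightarrow> head c p \<in> Se c) \<and>
     (\<forall>p\<in>P. head c p \<in> Se c \<longrightarrow> status c p = Undecided \<or> Se c = {head c p}) \<and>
     (\<forall>p\<in>P. tail c p \<noteq> head c p \<longrightarrow> tail c p \<notin> Se c \<and> status c p = Undecided) \<and>
     (\<forall>x. boundary_point (Se c) x \<longrightarrow> (\<exists>p\<in>P. head c p = x)) \<and>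
     (\<forall>p\<in>P. head c p \<in> Se c \<longrightarrow> (\<forall>i<6. elig c p i \<longleftrightarrow> port_pt ori p (head c p) i \<in> Se c)) \<and>
     (\<forall>p\<in>P. final c p \<longrightarrow> status c p \<noteq> Undecided)"

lemma invarD:
  assumes "invar P ori c"
  shows "simply_connected (Se c)" "Se c \<noteq> {}" "inj_on (head c) P"
    "p \<in> P \<Longrightarrow> status c p = Undecided \<Longrightarrow> head c p \<in> Se c"
    "p \<in> P \<Longrightarrow> head c p \<in> Se c \<Longrightarrow> status c p \<noteq> Undecided \<Longrightarrow> Se c = {head c p}"
    "p \<in> P \<Longrightarrow> tail c p \<noteq> head c p \<Longrightarrow> tail c p \<notin> Se c"
    "p \<in> P \<Longrightarrow> tail c p \<noteq> head c p \<Longrightarrow> status c p = Undecided"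
    "boundary_point (Se c) x \<Longrightarrow> \<exists>p\<in>P. head c p = x"
    "p \<in> P \<Longrightarrow> head c p \<in> Se c \<Longrightarrow> i < 6 \<Longrightarrow> elig c p i \<longleftrightarrow> port_pt ori p (head c p) i \<in> Se c"
    "p \<in> P \<Longrightarrow> final c p \<Longrightarrow> status c p \<noteq> Undecided"
  using assms unfolding invar_def by blast+

lemma dle_step_cases:
  assumes "dle_step P ori p c c'"
  obtains (stay) "c' = c"
  | (contract) "\<not> final c p" "head c p \<noteq> tail c p" "c' = c\<lparr>tail := (tail c)(p := head c p)\<rparr>"
  | (finish) "\<not> final c p" "head c p = tail c p" "term_cond P c p" "c' = c\<lparr>final := (final c)(p := True)\<rparr>"
  | (lead) "\<not> final c p" "head c p = tail c p" "status c p = Undecided" "\<forall>i<6. \<not> elig c p i"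
      "c' = c\<lparr>status := (status c)(p := Leader)\<rparr>"
  | (move) u i where "\<not> final c p" "head c p = tail c p" "status c p = Undecided" "i < 6" "elig c p i"
      "SCE (Se c) (head c p)" "adj (head c p) u" "u \<in> Se c - {head c p}" "\<not> occupied P c u"
      "c' = c\<lparr>head := (head c)(p := u),
         elig := (elig_after_removal P ori c p (head c p))(p := (\<lambda>j. port_pt ori p u j \<noteq> head c p)),
         Se := Se c - {head c p}\<rparr>"
  | (follow) i where "\<not> final c p" "head c p = tail c p" "status c p = Undecided" "i < 6" "elig c p i"
      "SCE (Se c) (head c p)" "\<And>u. adj (head c p) u \<Longrightarrow> u \<in> Se c - {head c p} \<Longrightarrow> occupied P c u"
      "c' = c\<lparr>status := (status c)(p := Follower), elig := elig_after_removal P ori c p (head c p),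
         Se := Se c - {head c p}\<rparr>"
proof -
  note st = assms[unfolded dle_step_def Let_def]
  show thesis
  proof (cases "final c p")
    case True
    then show thesis using st stay by simp
  next
    case nf: False
    note st = st[unfolded if_not_P[OF nf]]
    show thesis
    proof (cases "head c p = tail c p")
      case False
      then show thesis using st contract nf by simp
    next
      case ht: True
      note st = st[unfolded if_not_P[OF not_not[THEN iffD2, OF ht]]]
      show thesis
      proof (cases "term_cond P c p")
        case True
        then show thesis using st finish nf ht by simp
      next
        case nt: False
        note st = st[unfolded if_not_P[OF nt]]
        show thesis
        proof (cases "status c p = Undecided")
          case False
          then show thesis using st stay by simp
        next
          case un: True
          note st = st[unfolded if_P[OF un]]
          show thesis
          proof (cases "\<forall>i<6. \<not> elig c p i")
            case True
            then show thesis using st lead nf ht un by simp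
          next
            case el: False
            note st = st[unfolded if_not_P[OF el]]
            from el obtain i where i: "i < 6" "elig c p i" by blast
            show thesis
            proof (cases "SCE (Se c) (head c p)")
              case False
              then show thesis using st stay by simp
            next
              case sce: True
              note st = st[unfolded if_P[OF sce]]
              show thesis
              proof (cases "\<exists>u. adj (head c p) u \<and> u \<in> Se c - {head c p} \<and> \<not> occupied P c u")
                case True
                with st show thesis using move[OF nf ht un i sce] by (simp only: if_True) blast
              next
                case False
                note st = st[unfolded if_not_P[OF False]]
                show thesis by (rule follow[OF nf ht un i sce _ st]) (use False in blast)
              qed
            qed
          qed
        qed
      qed
    qed
  qed
qed

lemma elig_after_removal_iff:
  "q \<in> P \<Longrightarrow> q \<noteq> p \<Longrightarrow> elig_after_removal P ori c p v q j \<longleftrightarrow> elig c q j \<and> port_pt ori q (head c q) j \<noteq> v"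
  using port_pt_adj[of "head c q" ori q j] unfolding elig_after_removal_def by auto

text \<open>In every erosion the only possible newly exposed point is covered. A moving particle
  covers it by expanding into it; if the particle becomes a follower instead, all eligible
  neighbours were occupied already, and by heads since tails are not eligible. A leader has no
  eligible neighbour, so by connectedness its point is the last one.\<close>

lemma invar_step:
  assumes I: "invar P ori c" and p: "p \<in> P" and st: "dle_step P ori p c c'"
  shows "invar P ori c'"
  using st
proof (cases rule: dle_step_cases)
  case stay
  then show ?thesis using I by simp
next
  case contract
  then show ?thesis using I p unfolding invar_def by auto
next
  case finish
  then show ?thesis using I p unfolding invar_def term_cond_def by auto
next
  case lead
  have h: "head c p \<in> Se c" using invarD(4)[OF I p lead(3)] .
  have "u \<notin> Se c" if u: "adj (head c p) u" for u
  proof -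
    obtain i where "i < 6" "port_pt ori p (head c p) i = u" using adj_port_ptE[OF u] by blast
    then show ?thesis using invarD(9)[OF I p h, of i] lead(4) by blast
  qed
  then have "Se c = {head c p}"
    using connected_isolated[of "Se c"] h invarD(1)[OF I] by (simp add: simply_connected_def)
  then have one: "q = p" if "q \<in> P" "head c q \<in> Se c" for q
    using inj_onD[OF invarD(3)[OF I], of q p] that p by auto
  have c': "head c' = head c" "tail c' = tail c" "status c' = (status c)(p := Leader)" "final c' = final c"
    "elig c' = elig c" "Se c' = Se c"
    using lead by simp_all
  have "\<forall>q\<in>P. status c' q = Undecided \<longrightarrow> head c' q \<in> Se c'"
    using invarD(4)[OF I] unfolding c' by (metis fun_upd_apply status.distinct(1))
  moreover have "\<forall>q\<in>P. head c' q \<in> Se c' \<longrightarrow> status c' q = Undecided \<or> Se c' = {head c' q}"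
    using one \<open>Se c = {head c p}\<close> unfolding c' by metis
  moreover have "\<forall>q\<in>P. tail c' q \<noteq> head c' q \<longrightarrow> tail c' q \<notin> Se c' \<and> status c' q = Undecided"
    using invarD(6,7)[OF I] lead(2) unfolding c' by (metis fun_upd_apply)
  moreover have "\<forall>q\<in>P. final c' q \<longrightarrow> status c' q \<noteq> Undecided"
    using invarD(10)[OF I] lead(1) unfolding c' by (metis fun_upd_apply)
  ultimately show ?thesis
    using invarD(1-3,8,9)[OF I] unfolding invar_def c' by blast
next
  case (move u i)
  define v where "v = head c p"
  have c': "head c' = (head c)(p := u)" "tail c' = tail c" "status c' = status c" "final c' = final c"
    "elig c' = (elig_after_removal P ori c p v)(p := (\<lambda>j. port_pt ori p u j \<noteq> v))" "Se c' = Se c - {v}"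
    using move by (simp_all add: v_def)
  have v: "v \<in> Se c" "SCE (Se c) v" "head c p = v" "tail c p = v"
    using invarD(4)[OF I p move(3)] move by (simp_all add: v_def)
  have u: "adj v u" "u \<in> Se c" "u \<noteq> v" "\<not> occupied P c u"
    using move by (simp_all add: v_def)
  have sc: "simply_connected (Se c)" and holes: "hole_points (Se c) = {}"
    using invarD(1)[OF I] by (simp_all add: simply_connected_def)
  \<comment> \<open>Boundary points are heads, so an unoccupied eligible point is interior.\<close>
  have u_int: "\<not> boundary_point (Se c) u"
    using invarD(8)[OF I] u(4) unfolding occupied_def by blast
  have other: "head c q \<noteq> v" "head c q \<noteq> u" if "q \<in> P" "q \<noteq> p" for q
    using that u(4) v(3) inj_onD[OF invarD(3)[OF I], of q p] p unfolding occupied_def by auto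
  have "inj_on (head c') P"
    using invarD(3)[OF I] other unfolding c' inj_on_def by (metis fun_upd_apply)
  moreover have "simply_connected (Se c')" unfolding c' by (rule simply_connected_remove[OF sc v(2)])
  moreover have "Se c' \<noteq> {}" using u c' by auto
  moreover have "\<forall>q\<in>P. status c' q = Undecided \<longrightarrow> head c' q \<in> Se c'"
    using invarD(4)[OF I] u other unfolding c' by auto
  moreover have "\<forall>q\<in>P. head c' q \<in> Se c' \<longrightarrow> status c' q = Undecided \<or> Se c' = {head c' q}"
    using invarD(5)[OF I] move(3) v(1) other unfolding c' by (metis DiffD1 fun_upd_apply singletonD)
  moreover have "\<forall>q\<in>P. tail c' q \<noteq> head c' q \<longrightarrow> tail c' q \<notin> Se c' \<and> status c' q = Undecided"
    using invarD(6,7)[OF I] move(3) v unfolding c' by auto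
  moreover have "\<exists>q\<in>P. head c' q = w" if "boundary_point (Se c') w" for w
  proof (cases "boundary_point (Se c) w")
    case True
    then obtain q where q: "q \<in> P" "head c q = w" using invarD(8)[OF I] by blast
    have "w \<noteq> v" using that c'(6) by (auto simp: boundary_point_iff)
    then have "q \<noteq> p" using q v(3) by auto
    then show ?thesis using q unfolding c' by (intro bexI[of _ q]) auto
  next
    case False
    then have "w \<in> Se c" "adj w v"
      using that unfolding c' boundary_point_iff by auto
    then have "w = u"
      using SCE_interior_nbr_unique[OF holes v(2) _ _ False u(2,1) u_int] adj_sym by blast
    then show ?thesis using p unfolding c' by (intro bexI[of _ p]) auto
  qed
  moreover have "elig c' q j \<longleftrightarrow> port_pt ori q (head c' q) j \<in> Se c'"
    if q: "q \<in> P" "head c' q \<in> Se c'" and j: "j < 6" for q j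
  proof (cases "q = p")
    case True
    \<comment> \<open>All neighbours of the interior point \<open>u\<close> were eligible, so
      resetting the array to true except towards \<open>v\<close> is correct.\<close>
    have "port_pt ori p u j \<in> Se c"
      using u_int u(2) port_pt_adj[of u ori p j] unfolding boundary_point_iff by blast
    then show ?thesis using True unfolding c' by simp
  next
    case False
    then have "head c q \<in> Se c" using q unfolding c' by auto
    then have "elig c q j \<longleftrightarrow> port_pt ori q (head c q) j \<in> Se c"
      using invarD(9)[OF I q(1)] j by blast
    then show ?thesis
      using False elig_after_removal_iff[OF q(1) False] unfolding c' by simp
  qed
  moreover have "\<forall>q\<in>P. final c' q \<longrightarrow> status c' q \<noteq> Undecided"
    using invarD(10)[OF I] unfolding c' by blast
  ultimately show ?thesis unfolding invar_def by blast
next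
  case (follow i)
  define v where "v = head c p"
  have c': "head c' = head c" "tail c' = tail c" "status c' = (status c)(p := Follower)" "final c' = final c"
    "elig c' = elig_after_removal P ori c p v" "Se c' = Se c - {v}"
    using follow by (simp_all add: v_def)
  have v: "v \<in> Se c" "SCE (Se c) v" "head c p = v" "tail c p = v"
    using invarD(4)[OF I p follow(3)] follow by (simp_all add: v_def)
  have sc: "simply_connected (Se c)"
    using invarD(1)[OF I] .
  have other: "head c q \<noteq> v" if "q \<in> P" "q \<noteq> p" for q
    using that v(3) inj_onD[OF invarD(3)[OF I], of q p] p by auto
  have "port_pt ori p v i \<in> Se c"
    using invarD(9)[OF I p, of i] v follow(4,5) by auto
  moreover have "port_pt ori p v i \<noteq> v"
    by (simp add: port_pt_def)
  ultimately have "Se c' \<noteq> {}" using c' by auto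
  moreover have "inj_on (head c') P"
    using invarD(3)[OF I] unfolding c' .
  moreover have "simply_connected (Se c')" unfolding c' by (rule simply_connected_remove[OF sc v(2)])
  moreover have "\<forall>q\<in>P. status c' q = Undecided \<longrightarrow> head c' q \<in> Se c'"
    using invarD(4)[OF I] other unfolding c' by auto
  moreover have "\<forall>q\<in>P. head c' q \<in> Se c' \<longrightarrow> status c' q = Undecided \<or> Se c' = {head c' q}"
    using invarD(5)[OF I] v other unfolding c' by (metis DiffD1 DiffD2 fun_upd_apply singletonD singletonI)
  moreover have "\<forall>q\<in>P. tail c' q \<noteq> head c' q \<longrightarrow> tail c' q \<notin> Se c' \<and> status c' q = Undecided"
    using invarD(6,7)[OF I] v unfolding c' by auto
  moreover have "\<exists>q\<in>P. head c' q = w" if w: "boundary_point (Se c') w" for w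
  proof (cases "boundary_point (Se c) w")
    case True
    then show ?thesis using invarD(8)[OF I] unfolding c' by blast
  next
    case False
    then have "w \<in> Se c - {v}" "adj w v"
      using w unfolding c' boundary_point_iff by auto
    then have w': "w \<in> Se c - {v}" "adj v w"
      using adj_sym by blast+
    then have "occupied P c w" using follow(7) unfolding v_def by blast
    then obtain q where "q \<in> P" "head c q = w \<or> tail c q = w" unfolding occupied_def by blast
    then have "q \<in> P \<and> head c q = w" using invarD(6)[OF I, of q] w'(1) by (metis DiffD1)
    then show ?thesis unfolding c' by blast
  qed
  moreover have "elig c' q j \<longleftrightarrow> port_pt ori q (head c' q) j \<in> Se c'"
    if q: "q \<in> P" "head c' q \<in> Se c'" and j: "j < 6" for q j
  proof -
    have "q \<noteq> p" "head c q \<in> Se c" using q v unfolding c' by auto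
    then have "elig c q j \<longleftrightarrow> port_pt ori q (head c q) j \<in> Se c"
      using invarD(9)[OF I q(1)] j by blast
    then show ?thesis
      using elig_after_removal_iff[OF q(1) \<open>q \<noteq> p\<close>] unfolding c' by simp
  qed
  moreover have "\<forall>q\<in>P. final c' q \<longrightarrow> status c' q \<noteq> Undecided"
    using invarD(10)[OF I] follow(1) unfolding c' by auto
  ultimately show ?thesis unfolding invar_def by blast
qed

section \<open>Effects of single activations\<close>

lemma step_Se:
  assumes "dle_step P ori p c c'"
  shows "Se c' = Se c \<or> SCE (Se c) (head c p) \<and> Se c' = Se c - {head c p}"
  using assms by (cases rule: dle_step_cases) auto

lemma step_decided:
  "dle_step P ori p c c' \<Longrightarrow> status c q \<noteq> Undecided \<Longrightarrow> status c' q \<noteq> Undecided"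
  by (cases rule: dle_step_cases) (auto split: if_splits)

lemma step_final:
  "dle_step P ori p c c' \<Longrightarrow> final c q \<Longrightarrow> final c' q"
  by (cases rule: dle_step_cases) auto

lemma step_keeps_head:
  assumes "invar P ori c" "dle_step P ori p c c'" "q \<in> P" "head c q \<in> Se c'"
  shows "head c' q = head c q" "tail c q = head c q \<Longrightarrow> tail c' q = head c q"
  using assms(2,4) by (cases rule: dle_step_cases; auto)+

lemma step_contracts:
  assumes "invar P ori c" "dle_step P ori p c c'" "p \<in> P" "status c p = Undecided" "tail c p \<noteq> head c p"
  shows "tail c' p = head c' p"
  using assms(2)
proof (cases rule: dle_step_cases)
  case stay
  have "\<not> final c p" using invarD(10)[OF assms(1,3)] assms(4) by blast
  then have "c' = c\<lparr>tail := (tail c)(p := head c p)\<rparr>"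
    using assms(2,5) unfolding dle_step_def by (simp only: if_False if_True refl simp_thms) presburger
  then show ?thesis by simp
qed (use assms(5) in auto)

text \<open>By connectedness some neighbour is eligible, and the array of \<open>p\<close> shows it;
  this rules out the leader branch.\<close>

lemma step_erodes:
  assumes I: "invar P ori c" "dle_step P ori p c c'" "p \<in> P" "status c p = Undecided" "tail c p = head c p"
    and "SCE (Se c) (head c p)" "Se c \<noteq> {head c p}"
  shows "head c p \<notin> Se c'"
proof -
  have h: "head c p \<in> Se c" using invarD(4)[OF I(1,3,4)] .
  then obtain u where "adj (head c p) u" "u \<in> Se c"
    using connected_isolated[of "Se c" "head c p"] invarD(1)[OF I(1)] assms(7) by (auto simp: simply_connected_def)
  then obtain i where "i < 6" "elig c p i"
    using adj_port_ptE[of "head c p" u ori p] invarD(9)[OF I(1,3) h] by metis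
  moreover have "\<not> final c p" "\<not> term_cond P c p"
    using invarD(10)[OF I(1,3)] I(4) by (auto simp: term_cond_def)
  ultimately show ?thesis
    using I(2,4,5) assms(6) unfolding dle_step_def Let_def by (auto split: if_splits)
qed

lemma step_elects:
  assumes I: "invar P ori c" "dle_step P ori p c c'" "p \<in> P" "tail c p = head c p"
    and "Se c = {head c p}"
  shows "status c' p \<noteq> Undecided"
proof (cases "status c p = Undecided")
  case True
  have "\<not> elig c p i" if "i < 6" for i
    using invarD(9)[OF I(1,3) _ that] assms(5) by (auto simp: port_pt_def)
  moreover have "\<not> final c p" "\<not> term_cond P c p"
    using invarD(10)[OF I(1,3)] True by (auto simp: term_cond_def)
  ultimately show ?thesis
    using I(2,4) True unfolding dle_step_def by auto
qed (use step_decided[OF I(2)] in blast)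

lemma step_finishes:
  assumes I: "invar P ori c" "dle_step P ori p c c'" "p \<in> P" and dec: "\<And>q. q \<in> P \<Longrightarrow> status c q \<noteq> Undecided"
  shows "final c' p"
proof -
  have "head c p = tail c p" using invarD(7)[OF I(1,3)] dec[OF I(3)] by metis
  moreover have "term_cond P c p"
    using dec I(3) by (auto simp: term_cond_def neighbors_def)
  ultimately show ?thesis using I(2) unfolding dle_step_def by (auto split: if_splits)
qed

section \<open>Distances in the area\<close>

text \<open>Paths by their length and ends only, so that induction on the length replaces reasoning
  about lists.\<close>

definition walk :: "point set \<Rightarrow> point \<Rightarrow> point \<Rightarrow> nat \<Rightarrow> bool" where
  "walk A u v n \<longleftrightarrow> (\<exists>xs. is_path_in A xs \<and> hd xs = u \<and> last xs = v \<and> length xs = Suc n)"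

lemma dist_in_walk: "dist_in A u v = (LEAST n. walk A u v n)"
  by (simp add: dist_in_def walk_def)

lemma walk_0: "walk A u v 0 \<longleftrightarrow> u = v \<and> u \<in> A"
proof
  assume "walk A u v 0"
  then show "u = v \<and> u \<in> A"
    by (auto simp: walk_def is_path_in_def length_Suc_conv)
next
  assume "u = v \<and> u \<in> A"
  then show "walk A u v 0"
    unfolding walk_def by (intro exI[of _ "[v]"]) (auto simp: is_path_in_def)
qed

lemma walk_Suc: "walk A u w (Suc n) \<longleftrightarrow> w \<in> A \<and> (\<exists>v. walk A u v n \<and> adj v w)"
proof
  assume "walk A u w (Suc n)"
  then obtain xs where xs: "is_path_in A xs" "hd xs = u" "last xs = w" "length xs = Suc (Suc n)"
    by (auto simp: walk_def)
  have ne: "xs \<noteq> []" "butlast xs \<noteq> []" using xs(4) by (auto simp: neq_Nil_conv length_Suc_conv)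
  have "is_path_in A (butlast xs)"
    using xs ne unfolding is_path_in_def
    by (auto simp: nth_butlast dest: in_set_butlastD)
  moreover have "hd (butlast xs) = u" "length (butlast xs) = Suc n"
    using xs ne by (simp_all add: hd_conv_nth nth_butlast)
  moreover have "last (butlast xs) = xs ! n" "w = xs ! Suc n"
    using xs ne by (simp_all add: last_conv_nth nth_butlast)
  moreover have "adj (xs ! n) (xs ! Suc n)" "w \<in> A"
    using xs ne last_in_set[of xs] unfolding is_path_in_def by auto
  ultimately show "w \<in> A \<and> (\<exists>v. walk A u v n \<and> adj v w)"
    unfolding walk_def by metis
next
  assume "w \<in> A \<and> (\<exists>v. walk A u v n \<and> adj v w)"
  then obtain v xs where *: "w \<in> A" "adj v w" "is_path_in A xs" "hd xs = u" "last xs = v" "length xs = Suc n"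
    by (auto simp: walk_def)
  have ne: "xs \<noteq> []" using * by auto
  have "adj ((xs @ [w]) ! i) ((xs @ [w]) ! Suc i)" if "Suc i < length (xs @ [w])" for i
  proof (cases "Suc i < length xs")
    case True
    then show ?thesis using * unfolding is_path_in_def by (simp add: nth_append)
  next
    case False
    then have "i = n" using that * by simp
    then show ?thesis using * ne by (simp add: nth_append last_conv_nth)
  qed
  then have "is_path_in A (xs @ [w])"
    using * ne unfolding is_path_in_def by auto
  then show "walk A u w (Suc n)"
    unfolding walk_def using * ne by (intro exI[of _ "xs @ [w]"]) simp
qed

lemma walk_in: "walk A u v n \<Longrightarrow> u \<in> A \<and> v \<in> A"
  by (induction n arbitrary: v) (auto simp: walk_0 walk_Suc)

lemma walk_trans: "walk A u v m \<Longrightarrow> walk A v w n \<Longrightarrow> walk A u w (m + n)"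
  by (induction n arbitrary: w) (auto simp: walk_0 walk_Suc)

lemma walk_sym: "walk A u v n \<Longrightarrow> walk A v u n"
proof (induction n arbitrary: v)
  case (Suc n)
  then obtain w where w: "v \<in> A" "walk A u w n" "adj w v" by (auto simp: walk_Suc)
  have "w \<in> A" using walk_in w by blast
  then have "walk A v w (Suc 0)" using w by (auto simp: walk_Suc walk_0 adj_commute)
  from walk_trans[OF this Suc.IH[OF w(2)]] show ?case by simp
qed (simp add: walk_0)

lemma reach_walk: "reach A u v \<Longrightarrow> u \<in> A \<Longrightarrow> \<exists>n. walk A u v n"
proof (induction rule: reach_induct)
  case base
  then show ?case using walk_0 by blast
next
  case (step y z)
  then show ?case using walk_Suc by blast
qed

lemma walk_reach: "walk A u v n \<Longrightarrow> reach A u v"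
proof (induction n arbitrary: v)
  case (Suc n)
  then obtain w where w: "v \<in> A" "walk A u w n" "adj w v" by (auto simp: walk_Suc)
  then show ?case using Suc.IH walk_in by (meson reach_step reach_trans)
qed (simp add: walk_0)

lemma walk_mono: "walk A u v n \<Longrightarrow> A \<subseteq> B \<Longrightarrow> walk B u v n"
  by (induction n arbitrary: v) (auto simp: walk_0 walk_Suc)

lemma walk_fst_bound: "walk A u v n \<Longrightarrow> \<bar>fst v - fst u\<bar> \<le> int n"
proof (induction n arbitrary: v)
  case (Suc n)
  then obtain w where w: "walk A u w n" "adj w v" by (auto simp: walk_Suc)
  have "\<bar>fst v - fst w\<bar> \<le> 1" using w(2) by (auto simp: adj_coord)
  then show ?case using Suc.IH[OF w(1)] by simp
qed (simp add: walk_0)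

lemma walk_ray: "(\<And>m. m \<le> n \<Longrightarrow> ray q i m \<in> A) \<Longrightarrow> walk A q (ray q i n) n"
proof (induction n)
  case 0
  then show ?case using 0[of 0] by (simp add: walk_0)
next
  case (Suc n)
  then show ?case using adj_ray unfolding walk_Suc by (metis le_Suc_eq order_refl)
qed

lemma dist_in_le: "walk A u v n \<Longrightarrow> dist_in A u v \<le> n"
  unfolding dist_in_walk by (rule Least_le)

lemma walk_dist_in: "walk A u v n \<Longrightarrow> walk A u v (dist_in A u v)"
  unfolding dist_in_walk by (rule LeastI)

lemma is_level_dist_in:
  assumes "connected_shape A" "l \<in> A"
  shows "is_level A l (dist_in A l)"
proof -
  have w: "walk A l x (dist_in A l x)" if "x \<in> A" for x
  proof -
    have "reach A l x" using assms that by (simp add: connected_shape_iff)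
    then show ?thesis using reach_walk[of A l x] assms(2) walk_dist_in by blast
  qed
  have "dist_in A l l = 0"
    using dist_in_le[of A l l 0] assms(2) by (simp add: walk_0)
  moreover have "\<exists>y\<in>A. adj x y \<and> dist_in A l x = dist_in A l y + 1" if x: "x \<in> A" "x \<noteq> l" for x
  proof -
    have "dist_in A l x \<noteq> 0" using w[OF x(1)] x(2) walk_0 by metis
    then obtain n where n: "dist_in A l x = Suc n" using not0_implies_Suc by blast
    then obtain y where y: "walk A l y n" "adj y x" using w[OF x(1)] walk_Suc by metis
    have "y \<in> A" using walk_in[OF y(1)] by blast
    have "dist_in A l y \<le> n" using dist_in_le[OF y(1)] .
    moreover have "dist_in A l x \<le> Suc (dist_in A l y)"
      using w[OF \<open>y \<in> A\<close>] y(2) x(1) walk_Suc by (intro dist_in_le) blast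
    ultimately show ?thesis
      using n y(2) \<open>y \<in> A\<close> adj_sym by (intro bexI[of _ y]) auto
  qed
  moreover have "dist_in A l x \<le> dist_in A l y + 1" if "x \<in> A" "y \<in> A" "adj x y" for x y
  proof -
    have "walk A l x (Suc (dist_in A l y))"
      using w[OF that(2)] that(1) adj_sym[OF that(3)] walk_Suc by blast
    then show ?thesis using dist_in_le by fastforce
  qed
  ultimately show ?thesis
    unfolding is_level_def using assms(2) by blast
qed

section \<open>The area of a finite connected shape\<close>

lemma area_iff: "q \<in> area S \<longleftrightarrow> q \<notin> outer_face S"
  by (auto simp: area_def hole_points_def outer_face_iff)

lemma outer_face_step: "reach (- S) q r \<Longrightarrow> r \<in> outer_face S \<Longrightarrow> q \<notin> S \<Longrightarrow> q \<in> outer_face S"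
  by (rule outer_face_reach) auto

text \<open>From a point outside a bounding box, moving parallel to a coordinate axis keeps the
  offending coordinate, so this ray never meets \<open>S\<close>.\<close>

lemma finite_area:
  assumes "finite S"
  shows "finite (area S)"
proof -
  obtain M where M: "\<And>s. s \<in> S \<Longrightarrow> \<bar>fst s\<bar> \<le> M \<and> \<bar>snd s\<bar> \<le> M"
    using finite_shape_bound[OF assms] by blast
  have "\<bar>fst q\<bar> \<le> M \<and> \<bar>snd q\<bar> \<le> M" if q: "q \<in> area S" for q
  proof (rule ccontr)
    assume far: "\<not> ?thesis"
    have "\<exists>i. \<forall>n. ray q i n \<notin> S"
    proof (cases "\<bar>fst q\<bar> \<le> M")
      case True
      have "ray q 0 n \<notin> S" for n
        using M[of "ray q 0 n"] far True by (auto simp: ray_def)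
      then show ?thesis by blast
    next
      case False
      have "ray q 5 n \<notin> S" for n
        using M[of "ray q 5 n"] False by (auto simp: ray_def)
      then show ?thesis by blast
    qed
    then have "q \<in> outer_face S" using outer_face_ray by blast
    then show False using q by (simp add: area_iff)
  qed
  then have "area S \<subseteq> {-M..M} \<times> {-M..M}" by force
  then show ?thesis by (rule finite_subset) simp
qed

text \<open>The component of an outer point in the complement of \<open>S\<close> consists of outer
  points, so filling the holes leaves it intact and infinite.\<close>

lemma hole_points_area: "hole_points (area S) = {}"
proof (rule hole_freeI)
  fix q assume q: "q \<notin> area S"
  then have out: "q \<in> outer_face S" by (simp add: area_iff)
  have "reach (- area S) q r \<and> r \<in> outer_face S" if "reach (- S) q r" for r
    using that
  proof (induction rule: reach_induct)
    case (step y z)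
    then have "reach (- S) z y" by (intro reach_step) (auto simp: adj_sym)
    then have "z \<in> outer_face S" using outer_face_step step by blast
    then show ?case
      using step reach_step[of y "- area S" z] by (auto simp: area_iff intro: reach_trans)
  qed (use out in simp)
  then have "{r. reach (- S) q r} \<subseteq> {r. reach (- area S) q r}" by blast
  then show "q \<in> outer_face (area S)"
    using out q by (auto simp: outer_face_iff dest: finite_subset)
qed

lemma hole_ray_hits:
  assumes "h \<in> area S"
  obtains n where "ray h i n \<in> S" "\<And>m. m \<le> n \<Longrightarrow> ray h i m \<in> area S"
proof -
  have "\<exists>n. ray h i n \<in> S"
    using outer_face_ray assms area_iff by blast
  define n where "n = (LEAST n. ray h i n \<in> S)"
  have n: "ray h i n \<in> S" "\<And>m. m < n \<Longrightarrow> ray h i m \<notin> S"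
    using LeastI_ex[OF \<open>\<exists>n. ray h i n \<in> S\<close>] not_less_Least[of _ "\<lambda>n. ray h i n \<in> S"] unfolding n_def by blast+
  have "ray h i m \<in> area S" if "m \<le> n" for m
  proof (cases "m = n")
    case True
    then show ?thesis using n(1) by (simp add: area_def)
  next
    case False
    have "reach (- S) h (ray h i m)"
      by (rule reach_ray) (use n(2) that False in auto)
    moreover have "h \<notin> S" using n(2)[of 0] that False by simp
    ultimately show ?thesis
      using outer_face_step assms unfolding area_iff by blast
  qed
  then show thesis using that n(1) by blast
qed

lemma dist_in_le_diameter:
  assumes "finite S" "u \<in> S" "v \<in> S"
  shows "dist_in A u v \<le> diameter_wrt A S"
proof -
  have "{dist_in A u v | u v. u \<in> S \<and> v \<in> S} = (\<lambda>(u, v). dist_in A u v) ` (S \<times> S)"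
    by auto
  then have "finite {dist_in A u v | u v. u \<in> S \<and> v \<in> S}"
    using assms(1) by simp
  then show ?thesis
    unfolding diameter_wrt_def by (rule Max_ge) (use assms(2,3) in blast)
qed

lemma walk_between:
  assumes "connected_shape S" "u \<in> S" "v \<in> S"
  shows "walk (area S) u v (dist_in (area S) u v)"
proof -
  have "reach S u v" using assms by (simp add: connected_shape_iff)
  then obtain n where "walk S u v n" using reach_walk assms(2) by blast
  then have "walk (area S) u v n" by (rule walk_mono) (auto simp: area_def)
  then show ?thesis by (rule walk_dist_in)
qed

text \<open>A hole point lies on a horizontal segment inside the area with both ends in the shape;
  such a segment is a geodesic, so its length is at most the diameter.\<close>

lemma walk_to_shape:
  assumes S: "finite S" "connected_shape S" and h: "h \<in> area S"
  shows "\<exists>e\<in>S. \<exists>m\<le>diameter_wrt (area S) S. walk (area S) h e m"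
proof -
  obtain n where n: "ray h 0 n \<in> S" "\<And>m. m \<le> n \<Longrightarrow> ray h 0 m \<in> area S"
    using hole_ray_hits[OF h] by blast
  obtain k where k: "ray h 3 k \<in> S"
    using hole_ray_hits[OF h] by blast
  have "int (n + k) = \<bar>fst (ray h 0 n) - fst (ray h 3 k)\<bar>"
    by (simp add: ray_def)
  also have "\<dots> \<le> int (dist_in (area S) (ray h 3 k) (ray h 0 n))"
    by (rule walk_fst_bound[OF walk_between[OF S(2) k n(1)]])
  also have "\<dots> \<le> int (diameter_wrt (area S) S)"
    using dist_in_le_diameter[OF S(1) k n(1)] by simp
  finally have "n \<le> diameter_wrt (area S) S" by simp
  moreover have "walk (area S) h (ray h 0 n) n"
    by (rule walk_ray) (rule n(2))
  ultimately show ?thesis using n(1) by blast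
qed

text \<open>The factor 3: each end needs a walk to the shape of at most one diameter, and one more
  diameter joins the two points reached.\<close>

lemma walk_in_area:
  assumes S: "finite S" "connected_shape S" and "x \<in> area S" "y \<in> area S"
  shows "\<exists>n\<le>3 * diameter_wrt (area S) S. walk (area S) x y n"
proof -
  obtain e m where e: "e \<in> S" "m \<le> diameter_wrt (area S) S" "walk (area S) x e m"
    using walk_to_shape[OF S assms(3)] by blast
  obtain f k where f: "f \<in> S" "k \<le> diameter_wrt (area S) S" "walk (area S) y f k"
    using walk_to_shape[OF S assms(4)] by blast
  have "walk (area S) x y (m + dist_in (area S) e f + k)"
    using e f walk_between[OF S(2) e(1) f(1)] walk_sym walk_trans by blast
  moreover have "m + dist_in (area S) e f + k \<le> 3 * diameter_wrt (area S) S"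
    using e f dist_in_le_diameter[OF S(1) e(1) f(1), of "area S"] by simp
  ultimately show ?thesis by blast
qed

lemma simply_connected_area:
  assumes "finite S" "connected_shape S"
  shows "simply_connected (area S)"
  unfolding simply_connected_def connected_shape_iff
  using finite_area[OF assms(1)] hole_points_area walk_in_area[OF assms] walk_reach by blast

lemma invar_initial:
  assumes "initial_config P ori c"
  shows "invar P ori c"
proof -
  define S where "S = head c ` P"
  have I: "finite S" "connected_shape S" "S \<noteq> {}" "inj_on (head c) P" "Se c = area S"
    "\<And>p. p \<in> P \<Longrightarrow> tail c p = head c p" "\<And>p. p \<in> P \<Longrightarrow> status c p = Undecided" "\<And>p. p \<in> P \<Longrightarrow> \<not> final c p"
    "\<And>p i. p \<in> P \<Longrightarrow> i < 6 \<Longrightarrow> elig c p i = (port_pt ori p (head c p) i \<notin> outer_face S)"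
    using assms unfolding initial_config_def S_def by auto
  have head: "head c p \<in> area S" if "p \<in> P" for p
    using that by (simp add: area_def S_def)
  have b: "\<exists>p\<in>P. head c p = x" if x: "boundary_point (area S) x" for x
  proof -
    obtain u where u: "x \<in> area S" "adj x u" "u \<in> outer_face S"
      using x by (auto simp: boundary_point_iff area_iff)
    \<comment> \<open>A hole point cannot touch the outer face, as it would then belong to
      it.\<close>
    have "x \<in> S"
    proof (rule ccontr)
      assume "x \<notin> S"
      then have "reach (- S) x u" using u by (intro reach_step) (auto simp: outer_face_iff)
      then show False using outer_face_step u \<open>x \<notin> S\<close> by (auto simp: area_iff)
    qed
    then show ?thesis by (auto simp: S_def)
  qed
  show ?thesis
    unfolding invar_def I(5)
  proof (intro conjI ballI allI impI)
    show "area S \<noteq> {}" using I(3) by (auto simp: area_def)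
    show "elig c p i = (port_pt ori p (head c p) i \<in> area S)" if "p \<in> P" "i < 6" for p i
      using I(9)[OF that] by (simp add: area_iff)
  qed (use simply_connected_area[OF I(1,2)] I(4,6-8) head b in \<open>simp_all\<close>)
qed

section \<open>Counting rounds\<close>

declare round_end.simps(2) [simp del]

text \<open>The \<open>LEAST\<close> is attained: fairness gives each particle a later activation,
  and the maximum over the finite set \<open>P\<close> bounds them.\<close>

lemma round_end_step:
  assumes "finite P" "fair P a"
  shows "round_end P a k < round_end P a (Suc k)"
    and "p \<in> P \<Longrightarrow> \<exists>t. round_end P a k \<le> t \<and> t < round_end P a (Suc k) \<and> a t = p"
proof -
  let ?r = "round_end P a k"
  have "\<forall>p\<in>P. \<exists>t. ?r \<le> t \<and> a t = p"
    using assms(2) unfolding fair_def by blast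
  then obtain f where "\<forall>p\<in>P. ?r \<le> f p \<and> a (f p) = p"
    by (rule bchoice[THEN exE])
  then have f: "\<And>p. p \<in> P \<Longrightarrow> ?r \<le> f p \<and> a (f p) = p"
    by blast
  define T where "T = Suc (Max (insert ?r (f ` P)))"
  have "?r < T" "\<And>p. p \<in> P \<Longrightarrow> f p < T"
    using assms(1) unfolding T_def by (auto simp: less_Suc_eq_le)
  then have T: "f p \<in> {?r..<T}" if "p \<in> P" for p
    using f that by auto
  have "P \<subseteq> a ` {?r..<T}"
  proof
    fix p assume "p \<in> P"
    then show "p \<in> a ` {?r..<T}" using f T by (intro image_eqI[of p a "f p"]) simp_all
  qed
  with \<open>?r < T\<close> have "?r < T \<and> P \<subseteq> a ` {?r..<T}" by blast
  from LeastI[of "\<lambda>t. ?r < t \<and> P \<subseteq> a ` {?r..<t}", OF this]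
  have *: "?r < round_end P a (Suc k)" "P \<subseteq> a ` {?r..<round_end P a (Suc k)}"
    by (simp_all add: round_end.simps(2))
  show "?r < round_end P a (Suc k)" by (rule *(1))
  show "\<exists>t. ?r \<le> t \<and> t < round_end P a (Suc k) \<and> a t = p" if "p \<in> P"
  proof -
    have "p \<in> a ` {?r..<round_end P a (Suc k)}" using that *(2) by blast
    then obtain t where "t \<in> {?r..<round_end P a (Suc k)}" "a t = p" by blast
    then show ?thesis by (intro exI[of _ t]) simp
  qed
qed

locale dle_run =
  fixes P :: "nat set" and ori :: "nat \<Rightarrow> nat" and c :: "nat \<Rightarrow> config" and a :: "nat \<Rightarrow> nat"
  assumes init: "initial_config P ori (c 0)" and exec: "dle_execution P ori c a" and fair: "fair P a"
begin

abbreviation "S \<equiv> head (c 0) ` P"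
abbreviation "r \<equiv> round_end P a"

lemma finite_P: "finite P"
  using init by (simp add: initial_config_def)

lemma run_step: "a t \<in> P" "dle_step P ori (a t) (c t) (c (Suc t))"
  using exec by (simp_all add: dle_execution_def)

lemma invar: "invar P ori (c t)"
proof (induction t)
  case 0
  show ?case by (rule invar_initial[OF init])
next
  case (Suc t)
  then show ?case using invar_step run_step by blast
qed

lemma Se_antimono: "s \<le> t \<Longrightarrow> Se (c t) \<subseteq> Se (c s)"
proof (induction t rule: dec_induct)
  case (step n)
  then show ?case using step_Se[OF run_step(2)[of n]] by blast
qed simp

lemma Se_0: "Se (c 0) = area S"
  using init by (simp add: initial_config_def)

lemma r_mono: "m \<le> n \<Longrightarrow> r m \<le> r n"
  by (rule lift_Suc_mono_le) (use round_end_step(1)[OF finite_P fair] in \<open>simp_all only: less_imp_le\<close>)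

lemma activated: "p \<in> P \<Longrightarrow> \<exists>t. r k \<le> t \<and> t < r (Suc k) \<and> a t = p"
  using round_end_step(2)[OF finite_P fair] .

lemma decided_mono: "s \<le> t \<Longrightarrow> status (c s) p \<noteq> Undecided \<Longrightarrow> status (c t) p \<noteq> Undecided"
  by (induction t rule: dec_induct) (use step_decided run_step(2) in blast)+

lemma final_mono: "s \<le> t \<Longrightarrow> final (c s) p \<Longrightarrow> final (c t) p"
  by (induction t rule: dec_induct) (use step_final run_step(2) in blast)+

text \<open>At a time of minimal cardinality the decreasing sets have become constant, and they are
  never empty.\<close>

lemma ex_survivor: "\<exists>l. \<forall>t. l \<in> Se (c t)"
proof -
  obtain t where t: "\<And>s. card (Se (c t)) \<le> card (Se (c s))"
    using ex_has_least_nat[of "\<lambda>_. True" 0 "\<lambda>t. card (Se (c t))"] by blast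
  have fin: "finite (Se (c s))" for s
    using invarD(1)[OF invar] by (simp add: simply_connected_def)
  obtain l where l: "l \<in> Se (c t)" using invarD(2)[OF invar] by blast
  have "l \<in> Se (c s)" for s
  proof (cases "s \<le> t")
    case True
    then show ?thesis using Se_antimono l by blast
  next
    case False
    then have "Se (c s) = Se (c t)"
      using Se_antimono[of t s] card_seteq[OF fin _ t] by simp
    then show ?thesis using l by simp
  qed
  then show ?thesis by blast
qed

lemma level_Se:
  assumes "\<And>t. l \<in> Se (c t)" "is_level (area S) l d"
  shows "is_level (Se (c t)) l d"
proof (induction t)
  case 0
  show ?case using assms(2) Se_0 by simp
next
  case (Suc t)
  have "hole_points (Se (c t)) = {}"
    using invarD(1)[OF invar] by (simp add: simply_connected_def)
  note remove = is_level_remove[OF this Suc]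
  from step_Se[OF run_step(2)[of t]] show ?case
  proof
    assume "Se (c (Suc t)) = Se (c t)"
    then show ?thesis using Suc by simp
  next
    assume *: "SCE (Se (c t)) (head (c t) (a t)) \<and> Se (c (Suc t)) = Se (c t) - {head (c t) (a t)}"
    then have "head (c t) (a t) \<noteq> l" using assms(1)[of "Suc t"] by auto
    then show ?thesis using remove * by simp
  qed
qed

text \<open>A boundary point is the head of a particle; its first activation contracts it, if necessary,
  and its second one erodes the point.\<close>

lemma eroded_in_two_rounds:
  assumes l: "\<And>t. l \<in> Se (c t)" "x \<noteq> l"
    and sce: "\<And>t. r k \<le> t \<Longrightarrow> x \<in> Se (c t) \<Longrightarrow> SCE (Se (c t)) x"
  shows "x \<notin> Se (c (r (k + 2)))"
proof
  assume "x \<in> Se (c (r (k + 2)))"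
  then have x: "x \<in> Se (c t)" if "t \<le> r (k + 2)" for t
    using Se_antimono[OF that] by blast
  have "boundary_point (Se (c (r k))) x"
    using sce[OF order_refl x] r_mono[of k "k + 2"]
    unfolding SCE_def local_boundary_def by auto
  then obtain p where p: "p \<in> P" "head (c (r k)) p = x" using invarD(8)[OF invar] by blast
  have head: "head (c t) p = x" if "r k \<le> t" "t \<le> r (k + 2)" for t
    using that
  proof (induction t rule: dec_induct)
    case (step n)
    have "head (c n) p \<in> Se (c (Suc n))" using step x by simp
    then show ?case
      using step step_keeps_head(1)[OF invar run_step(2) p(1)] by simp
  qed (use p in simp)
  have und: "status (c t) p = Undecided" "Se (c t) \<noteq> {x}" if "r k \<le> t" "t \<le> r (k + 2)" for t
  proof -
    show "Se (c t) \<noteq> {x}" using l(1)[of t] l(2) by auto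
    then show "status (c t) p = Undecided"
      using invarD(5)[OF invar[of t] p(1)] head[OF that] x[OF that(2)] by metis
  qed
  obtain t1 where t1: "r k \<le> t1" "t1 < r (Suc k)" "a t1 = p" using activated p(1) by blast
  obtain t2 where t2: "r (Suc k) \<le> t2" "t2 < r (Suc (Suc k))" "a t2 = p" using activated p(1) by blast
  have erodes: "tail (c t) p \<noteq> x" if "r k \<le> t" "t < r (k + 2)" "a t = p" for t
  proof
    assume "tail (c t) p = x"
    then have "head (c t) p \<notin> Se (c (Suc t))"
      using step_erodes[OF invar, of p t "c (Suc t)"] run_step(2)[of t] that und[of t] head[of t] sce[of t] x[of t] p(1)
      by simp
    then show False using head[of t] x[of "Suc t"] that by simp
  qed
  have "Suc t1 \<le> t2" "t2 < r (k + 2)" using t1 t2 by simp_all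
  \<comment> \<open>By \<open>erodes\<close> the particle is still expanded at its first activation,
    which therefore contracts it.\<close>
  have contr: "tail (c (Suc t1)) p = x"
    using step_contracts[OF invar, of p t1 "c (Suc t1)"] run_step(2)[of t1] t1 t2 und[of t1] head[of t1] head[of "Suc t1"]
      erodes[of t1] p(1) by simp
  have contracted: "tail (c t) p = x" if "Suc t1 \<le> t" "t \<le> t2" for t
    using that
  proof (induction t rule: dec_induct)
    case (step n)
    have n: "head (c n) p = x" "x \<in> Se (c (Suc n))"
      using step t1(1) \<open>t2 < r (k + 2)\<close> head[of n] x[of "Suc n"] by simp_all
    then show ?case
      using step step_keeps_head(2)[OF invar run_step(2) p(1), of n] by simp
  qed (rule contr)
  show False
    using erodes[of t2] contracted[of t2] t1 t2 \<open>Suc t1 \<le> t2\<close> \<open>t2 < r (k + 2)\<close> by simp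
qed

text \<open>Erosion proceeds from the highest level down and from the ends of each row inwards: \<open>x\<close> at
  level \<open>d x\<close> and at most \<open>k\<close> steps from an end of its row waits for its upper neighbours and for one
  neighbour in its row, all of which have smaller rank \<open>2 * (D - d x) + k\<close>.\<close>

lemma erosion_schedule:
  assumes l: "\<And>t. l \<in> Se (c t)" and lev: "is_level (area S) l d"
    and D: "\<And>x. x \<in> area S \<Longrightarrow> d x \<le> D"
    and "x \<in> area S" "x \<noteq> l" "near (area S) d x k" "2 * (D - d x) + k < n"
  shows "x \<notin> Se (c (r (2 * n)))"
  using assms(4-)
proof (induction n arbitrary: x k)
  case (Suc n)
  have sub: "Se (c t) \<subseteq> area S" for t
    using Se_antimono[of 0 t] Se_0 by simp
  have geo: "geodesic (area S) d"
    using geodesic_if_simply_connected[OF _ lev] invarD(1)[OF invar[of 0]] Se_0 by simp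
  have pos: "0 < d y" if "y \<in> area S" "y \<noteq> l" for y
    using is_level_down[OF lev that] by auto
  have d_l: "d l = 0" using lev by (simp add: is_level_def)
  have "SCE (Se (c t)) x" if t: "r (2 * n) \<le> t" and x: "x \<in> Se (c t)" for t
  proof (rule SCE_if_top)
    show "hole_points (Se (c t)) = {}" "geodesic (Se (c t)) d"
      using invarD(1)[OF invar[of t]] geodesic_if_simply_connected[OF _ level_Se[OF l lev]]
      by (simp_all add: simply_connected_def)
    show "is_level (Se (c t)) l d" by (rule level_Se[OF l lev])
    show "x \<in> Se (c t)" "x \<noteq> l" by fact+
    show "d u \<noteq> d x + 1" if u: "u \<in> Se (c t)" "adj x u" for u
    proof
      assume up: "d u = d x + 1"
      have u_area: "u \<in> area S" using sub u by blast
      have "u \<notin> Se (c (r (2 * n)))"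
      proof (rule Suc.IH[OF u_area])
        show "u \<noteq> l" using up d_l by auto
        show "near (area S) d u (Suc k)"
          by (rule near_up[OF geo Suc.prems(1) u_area adj_sym[OF u(2)] up Suc.prems(3)])
        \<comment> \<open>The bound \<open>d u <= D\<close> makes the natural subtraction drop by
          exactly 1; doubled, this pays for the extra row step.\<close>
        show "2 * (D - d u) + Suc k < n"
          using Suc.prems(4) up D[OF u_area] by simp
      qed
      then show False using u(1) Se_antimono[OF t] by blast
    qed
    show "\<not> flat (Se (c t)) d x i" for i
    proof
      assume fl: "flat (Se (c t)) d x i"
      \<comment> \<open>Rows are measured in the area, so flatness has to be carried there from the
        current set.\<close>
      have fl': "flat (area S) d x i" by (rule flat_mono[OF fl sub])
      show False
      proof (cases k)
        case 0
        then show False using near_0 Suc.prems(3) fl' by blast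
      next
        case (Suc k')
        then have "near (area S) d (around x i True 0) k' \<or> near (area S) d (around x i True 3) k'"
          using near_side[OF geo fl'] Suc.prems(3) by blast
        then obtain y where y: "near (area S) d y k'" "y \<in> Se (c t)" "d y = d x"
          using fl unfolding flat_def by blast
        have "y \<notin> Se (c (r (2 * n)))"
        proof (rule Suc.IH[OF _ _ y(1)])
          show "y \<in> area S" using sub y(2) by blast
          show "y \<noteq> l" using y(3) d_l pos[OF Suc.prems(1,2)] by auto
          show "2 * (D - d y) + k' < n" using Suc.prems(4) y(3) Suc by simp
        qed
        then show False using y(2) Se_antimono[OF t] by blast
      qed
    qed
  qed
  then show ?case
    using eroded_in_two_rounds[of l x "2 * n"] l Suc.prems(2) by simp
qed simp

text \<open>The budget: with \<open>D\<close> three diameters, \<open>2 * (2 * D + 1)\<close> rounds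
  leave only \<open>l\<close>; then the particle on \<open>l\<close> needs at most one activation to
  contract and one to become leader, and a last round lets everyone terminate.\<close>

lemma all_final:
  assumes "12 * diameter_wrt (area S) S + 5 \<le> n" "p \<in> P"
  shows "final (c (r n)) p"
proof -
  have fin: "finite S" "connected_shape S"
    using init by (auto simp: initial_config_def)
  obtain l where l: "\<And>t. l \<in> Se (c t)" using ex_survivor by blast
  define d where "d = dist_in (area S) l"
  define D where "D = 3 * diameter_wrt (area S) S"
  have l_area: "l \<in> area S" using l[of 0] Se_0 by simp
  have lev: "is_level (area S) l d"
    unfolding d_def using simply_connected_area[OF fin] l_area
    by (intro is_level_dist_in) (simp_all add: simply_connected_def)
  have D: "d x \<le> D" if "x \<in> area S" for x
    using walk_in_area[OF fin l_area that] dist_in_le unfolding d_def D_def by (meson order_trans)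
  have "x \<notin> Se (c (r (2 * (2 * D + 1))))" if "x \<in> area S" "x \<noteq> l" for x
    \<comment> \<open>With \<open>k = d x\<close> the rank is \<open>2 * (D - d x) + d x\<close>, at
      most \<open>2 * D\<close>.\<close>
    by (rule erosion_schedule[OF l lev D that near_level[OF lev]]) (use D[OF that(1)] in simp_all)
  then have "Se (c (r (2 * (2 * D + 1)))) = {l}"
    using l Se_antimono[of 0 "r (2 * (2 * D + 1))"] Se_0 by auto
  then have Se: "Se (c t) = {l}" if "r (4 * D + 2) \<le> t" for t
    using Se_antimono[OF that] l[of t] by (auto simp: algebra_simps)
  define k where "k = 4 * D + 2"
  have "boundary_point (Se (c (r k))) l"
    unfolding boundary_point_iff Se[OF order_refl, folded k_def]
    by (intro conjI exI[of _ "nbr l 0"]) simp_all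
  then obtain q where q: "q \<in> P" "head (c (r k)) q = l" using invarD(8)[OF invar] by blast
  have Se': "Se (c t) = {l}" if "r k \<le> t" for t
    using Se that by (simp add: k_def)
  have head: "head (c t) q = l" if "r k \<le> t" for t
    using that
  proof (induction t rule: dec_induct)
    case (step n)
    have "head (c n) q \<in> Se (c (Suc n))" using step Se'[of "Suc n"] by simp
    then show ?case
      using step step_keeps_head(1)[OF invar run_step(2) q(1)] by simp
  qed (use q in simp)
  obtain t1 where t1: "r k \<le> t1" "t1 < r (Suc k)" "a t1 = q" using activated q(1) by blast
  obtain t2 where t2: "r (Suc k) \<le> t2" "t2 < r (Suc (Suc k))" "a t2 = q" using activated q(1) by blast
  have dec_q: "status (c (r (k + 2))) q \<noteq> Undecided"
  proof (rule ccontr)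
    assume "\<not> ?thesis"
    then have und: "status (c t) q = Undecided" if "t \<le> r (k + 2)" for t
      using decided_mono[OF that] by blast
    have elects: "tail (c t) q \<noteq> l" if "r k \<le> t" "t < r (k + 2)" "a t = q" for t
      using step_elects[OF invar, of q t "c (Suc t)"] run_step(2)[of t] that und[of "Suc t"] head[of t] Se'[of t] q(1)
      by auto
    have contr: "tail (c (Suc t1)) q = l"
      using step_contracts[OF invar, of q t1 "c (Suc t1)"] run_step(2)[of t1] t1 t2 und[of t1] head[of t1] head[of "Suc t1"]
        elects[of t1] q(1) by simp
    have contracted: "tail (c t) q = l" if "Suc t1 \<le> t" for t
      using that
    proof (induction t rule: dec_induct)
      case (step n)
      have "head (c n) q = l" "l \<in> Se (c (Suc n))"
        using step t1(1) l head[of n] by simp_all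
      then show ?case
        using step step_keeps_head(2)[OF invar run_step(2) q(1), of n] by simp
    qed (rule contr)
    show False
      using elects[of t2] contracted[of t2] t1 t2 by simp
  qed
  \<comment> \<open>Any other undecided particle would have its head in
    \<open>Se (c t) = {l}\<close>, where \<open>q\<close> already is.\<close>
  have dec: "status (c t) p \<noteq> Undecided" if p: "p \<in> P" and t: "r (k + 2) \<le> t" for p t
  proof (cases "p = q")
    case True
    then show ?thesis using dec_q decided_mono t by blast
  next
    case False
    have "r k \<le> t" using t r_mono[of k "k + 2"] by simp
    then have "head (c t) p \<noteq> l"
      using inj_onD[OF invarD(3)[OF invar] _ p q(1)] head False by metis
    then show ?thesis using invarD(4)[OF invar p] Se'[OF \<open>r k \<le> t\<close>] by blast
  qed
  obtain t3 where t3: "r (k + 2) \<le> t3" "t3 < r (Suc (k + 2))" "a t3 = p" using activated assms(2) by blast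
  have "final (c (Suc t3)) p"
    using step_finishes[OF invar, of p t3] run_step(2)[of t3] t3 dec assms(2) by simp
  moreover have "Suc t3 \<le> r n"
    using t3(2) r_mono[of "Suc (k + 2)" n] assms(1) by (simp add: k_def D_def)
  ultimately show ?thesis using final_mono by blast
qed

end

theorem theorem4p9:
  shows "\<exists>K::nat. \<forall>P ori c a.
     initial_config P ori (c 0) \<and> dle_execution P ori c a \<and> fair P a \<longrightarrow>
     (\<forall>p\<in>P. final (c (round_end P a
        (K * diameter_wrt (area (head (c 0) ` P)) (head (c 0) ` P) + K))) p)"
\<comment> \<open>The factor 12 comes from \<open>all_final\<close>; as additive constant it also
  covers the 5 remaining rounds, in particular when the diameter is 0.\<close>
proof (intro exI[of _ 12] allI impI ballI)
  fix P ori c a p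
  assume "initial_config P ori (c 0) \<and> dle_execution P ori c a \<and> fair P a" and p: "p \<in> P"
  then interpret dle_run P ori c a
    by unfold_locales blast+
  show "final (c (round_end P a
        (12 * diameter_wrt (area (head (c 0) ` P)) (head (c 0) ` P) + 12))) p"
    by (rule all_final) (use p in simp_all)
qed

end
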